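(* Let $p$ be a prime, let $F$ be a relatively free pro-$p$ group of finite rank, and let $1\neq u\in F$. If $\varphi$ is an endomorphism of $F$ such that $\varphi(\mathrm{Orb}(u))\subseteq \mathrm{Orb}(u)$, then $\varphi$ is an automorphism. In particular, this statement holds for free pro-$p$ groups $F$ of finite rank.
   Context: Homomorphisms between profinite groups are continuous; $\mathrm{Aut}(F)$ is the group of continuous automorphisms of $F$. The automorphic orbit of $g\in F$ is $\mathrm{Orb}(g)=\{\alpha(g)\mid \alpha\in \mathrm{Aut}(F)\}$. A relatively free pro-$p$ group of finite rank is a quotient $E/V$ of a free pro-$p$ group $E$ of finite rank by a closed fully invariant (verbal) subgroup $V$, i.e. a closed subgroup mapped into itself by all endomorphisms of $E$. *)

theory Defs
  imports "HOL-Analysis.Abstract_Topology" "HOL-Analysis.T1_Spaces" "HOL-Analysis.Product_Topology"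
    "HOL-Algebra.Coset" "HOL-Computational_Algebra.Primes" "HOL-Library.FuncSet"
begin

definition topological_group :: "'a monoid \<Rightarrow> 'a topology \<Rightarrow> bool" where
  "topological_group G T \<longleftrightarrow>
     group G \<and> topspace T = carrier G \<and>
     continuous_map (prod_topology T T) T (\<lambda>(x, y). x \<otimes>\<^bsub>G\<^esub> y) \<and>
     continuous_map T T (\<lambda>x. inv\<^bsub>G\<^esub> x)"

definition profinite_group :: "'a monoid \<Rightarrow> 'a topology \<Rightarrow> bool" where
  "profinite_group G T \<longleftrightarrow>
     topological_group G T \<and> compact_space T \<and> Hausdorff_space T \<and>
     (\<forall>U. openin T U \<and> \<one>\<^bsub>G\<^esub> \<in> U \<longrightarrow> (\<exists>H. subgroup H G \<and> openin T H \<and> H \<subseteq> U))"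

(* The index of an open subgroup is finite by compactness, so card is the genuine index here. *)
definition pro_p_group :: "nat \<Rightarrow> 'a monoid \<Rightarrow> 'a topology \<Rightarrow> bool" where
  "pro_p_group p G T \<longleftrightarrow>
     profinite_group G T \<and>
     (\<forall>N. N \<lhd> G \<and> openin T N \<longrightarrow> (\<exists>k. card (rcosets\<^bsub>G\<^esub> N) = p ^ k))"

(* Maps are total functions on the type, and only their values on the carrier matter. *)
definition cont_hom ::
  "'a monoid \<Rightarrow> 'a topology \<Rightarrow> 'b monoid \<Rightarrow> 'b topology \<Rightarrow> ('a \<Rightarrow> 'b) set" where
  "cont_hom G S H T = {f \<in> hom G H. continuous_map S T f}"

definition cont_iso ::
  "'a monoid \<Rightarrow> 'a topology \<Rightarrow> 'b monoid \<Rightarrow> 'b topology \<Rightarrow> ('a \<Rightarrow> 'b) set" where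
  "cont_iso G S H T = {f \<in> iso G H. homeomorphic_map S T f}"

abbreviation cont_end :: "'a monoid \<Rightarrow> 'a topology \<Rightarrow> ('a \<Rightarrow> 'a) set" where
  "cont_end G T \<equiv> cont_hom G T G T"

abbreviation cont_aut :: "'a monoid \<Rightarrow> 'a topology \<Rightarrow> ('a \<Rightarrow> 'a) set" where
  "cont_aut G T \<equiv> cont_iso G T G T"

definition aut_orbit :: "'a monoid \<Rightarrow> 'a topology \<Rightarrow> 'a \<Rightarrow> 'a set" where
  "aut_orbit G T g = {\<alpha> g | \<alpha>. \<alpha> \<in> cont_aut G T}"

(* Universal property of a basis X. A definition cannot quantify over all types, so the
   target groups H live on the fixed type "nat set", of cardinality the continuum. For
   finite X this loses nothing: a map from X to any pro-p group takes values in the closed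
   subgroup generated by the finite image of X. That subgroup has at most countably many
   open normal subgroups, hence at most continuum many elements, and so has an isomorphic
   copy on "nat set". *)
definition free_pro_p_on :: "nat \<Rightarrow> 'a monoid \<Rightarrow> 'a topology \<Rightarrow> 'a set \<Rightarrow> bool" where
  "free_pro_p_on p E T X \<longleftrightarrow>
     pro_p_group p E T \<and> X \<subseteq> carrier E \<and>
     (\<forall>(H :: nat set monoid) S f. pro_p_group p H S \<and> f \<in> X \<rightarrow> carrier H \<longrightarrow>
        (\<exists>!h. h \<in> extensional (carrier E) \<and> h \<in> cont_hom E T H S \<and> (\<forall>x\<in>X. h x = f x)))"

definition free_pro_p_finite_rank :: "nat \<Rightarrow> 'a monoid \<Rightarrow> 'a topology \<Rightarrow> bool" where
  "free_pro_p_finite_rank p E T \<longleftrightarrow> (\<exists>X. finite X \<and> free_pro_p_on p E T X)"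

(* Such a subgroup is normal, since inner automorphisms are continuous endomorphisms. *)
definition closed_fully_invariant :: "'a set \<Rightarrow> 'a monoid \<Rightarrow> 'a topology \<Rightarrow> bool" where
  "closed_fully_invariant V E T \<longleftrightarrow>
     subgroup V E \<and> closedin T V \<and> (\<forall>f \<in> cont_end E T. f ` V \<subseteq> V)"

definition quotient_group_topology ::
  "'a monoid \<Rightarrow> 'a topology \<Rightarrow> 'a set \<Rightarrow> 'a set topology" where
  "quotient_group_topology E T V =
     topology (\<lambda>U. U \<subseteq> carrier (E Mod V) \<and> openin T {x \<in> topspace T. V #>\<^bsub>E\<^esub> x \<in> U})"

lemma openin_quotient_group_topology:
  "openin (quotient_group_topology E T V) U \<longleftrightarrow>
     U \<subseteq> carrier (E Mod V) \<and> openin T {x \<in> topspace T. V #>\<^bsub>E\<^esub> x \<in> U}"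
proof -
  let ?L = "\<lambda>U. U \<subseteq> carrier (E Mod V) \<and> openin T {x \<in> topspace T. V #>\<^bsub>E\<^esub> x \<in> U}"
  have "?L (A \<inter> B)" if "?L A" "?L B" for A B
  proof -
    have "{x \<in> topspace T. V #>\<^bsub>E\<^esub> x \<in> A \<inter> B} =
        {x \<in> topspace T. V #>\<^bsub>E\<^esub> x \<in> A} \<inter> {x \<in> topspace T. V #>\<^bsub>E\<^esub> x \<in> B}" by blast
    then show ?thesis using that by auto
  qed
  moreover have "?L (\<Union>K)" if "\<forall>A\<in>K. ?L A" for K
  proof -
    have "{x \<in> topspace T. V #>\<^bsub>E\<^esub> x \<in> \<Union>K} =
        (\<Union>A\<in>K. {x \<in> topspace T. V #>\<^bsub>E\<^esub> x \<in> A})" by blast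
    then show ?thesis using that by auto
  qed
  ultimately have "istopology ?L" unfolding istopology_def by blast
  then show ?thesis by (simp add: quotient_group_topology_def topology_inverse')
qed

(* F is, up to isomorphism of topological groups, a quotient E/V. The type argument is the
   type carrying E. It is a parameter only because a definition cannot have a type variable
   on its right-hand side alone. *)
definition relatively_free_pro_p ::
  "'e itself \<Rightarrow> nat \<Rightarrow> 'a monoid \<Rightarrow> 'a topology \<Rightarrow> bool" where
  "relatively_free_pro_p TYPE('e) p F T \<longleftrightarrow>
     topological_group F T \<and>
     (\<exists>(E :: 'e monoid) S V.
        free_pro_p_finite_rank p E S \<and> closed_fully_invariant V E S \<and>
        cont_iso (E Mod V) (quotient_group_topology E S V) F T \<noteq> {})"

end

theory Submission
  imports Defs "HOL-Algebra.Group_Action" "HOL-Algebra.Multiplicative_Group"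
    "HOL-Algebra.Elementary_Groups" "HOL-Number_Theory.Cong"
begin

text \<open>The continuous endomorphisms mapping \<open>Orb(u)\<close> into itself form a monoid that contains
  \<open>Aut(F)\<close>. On \<open>F/\<Phi>(F)\<close> a non-automorphism \<open>\<phi>\<close> has a nonzero kernel, since surjective
  endomorphisms are automorphisms and \<open>F/\<Phi>(F)\<close> is finite. Because \<open>Aut(F)\<close> acts transitively on
  \<open>F - \<Phi>(F)\<close>, suitable products of \<open>\<phi>\<close> with automorphisms have ever larger kernels, and finally
  one of them, \<open>\<theta>\<close>, maps \<open>F\<close> into \<open>\<Phi>(F)\<close>. Then \<open>\<theta>\<close> is nilpotent on every finite quotient of
  \<open>F\<close> by a fully invariant open subgroup \<open>N\<close>, so \<open>N\<close> meets \<open>Orb(u)\<close> and hence contains \<open>u\<close>.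
  These \<open>N\<close> intersect trivially, which forces \<open>u = 1\<close>.\<close>

subsection \<open>Characters of finite p-groups\<close>

text \<open>Powers of \<phi> alone do not suffice: modulo the Frattini subgroup \<phi> may be
  invertible on a nonzero subspace. Interposed automorphisms move what survives into the kernel.

  The quotient by the Frattini subgroup is never treated as a vector space. Its dual is represented
  by integer-valued functions that are additive modulo \<open>p\<close>: the Frattini subgroup is
  their common kernel, and a proper closed subgroup is recognized by a nonzero character vanishing
  on it. Such characters come from finite p-groups, where they rest on counting fixed points.

  Finite rank supplies all finiteness: a homomorphism to a finite quotient is determined by its
  values on \<open>X\<close>, so the Frattini subgroup and the largest fully invariant subgroup
  inside an open normal one are finite intersections of open subgroups.

  Relative freeness enters only through two properties of \<open>X\<close>: it generates
  topologically, and every map from \<open>X\<close> to the group extends to a continuous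
  endomorphism. Both descend from \<open>E\<close> to \<open>E/V\<close>, because endomorphisms of
  \<open>E\<close> preserve \<open>V\<close>.\<close>

lemma (in group) inv_cancel_assoc:
  assumes "x \<in> carrier G" "y \<in> carrier G"
  shows "x \<otimes> (inv x \<otimes> y) = y" "inv x \<otimes> (x \<otimes> y) = y"
  using assms by (simp_all flip: m_assoc)

text \<open>Every orbit other than a fixed point has size divisible by \<open>p\<close>. If
  \<open>x\<close> were the only fixed point, \<open>card E\<close> would be 1 modulo
  \<open>p\<close>.\<close>

lemma (in group_action) another_fixed_point:
  assumes p: "prime p" and ord: "order G = p ^ k" and fin: "finite E" and dvd: "p dvd card E"
    and x: "x \<in> E" "\<And>g. g \<in> carrier G \<Longrightarrow> \<phi> g x = x"
  shows "\<exists>y\<in>E. y \<noteq> x \<and> (\<forall>g\<in>carrier G. \<phi> g y = y)"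
proof (rule ccontr)
  assume contra: "\<not> ?thesis"
  have ox: "orbit G \<phi> x = {x}"
    using x orbit_refl[of x] by (auto simp: orbit_def)
  then have xo: "{x} \<in> orbits G E \<phi>"
    using x(1) by (auto simp: orbits_def)
  have other: "p dvd card O'" if O': "O' \<in> orbits G E \<phi> - {{x}}" for O'
  proof -
    obtain y where y: "y \<in> E" "O' = orbit G \<phi> y" using O' by (auto simp: orbits_def)
    have "card O' dvd p ^ k"
      using orbit_stabilizer_theorem[OF y(1)] y(2) ord by (metis dvd_triv_left)
    then obtain i where i: "card O' = p ^ i" using divides_primepow_nat[OF p] by blast
    have "i \<noteq> 0"
    proof
      assume "i = 0"
      then have "card O' = 1" using i by simp
      then have "O' = {y}" using orbit_refl[OF y(1)] y(2) by (metis card_1_singletonE singletonD)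
      then have "\<forall>g\<in>carrier G. \<phi> g y = y" using y(2) by (auto simp: orbit_def)
      then have "y = x" using contra y(1) by blast
      then show False using O' \<open>O' = {y}\<close> by simp
    qed
    then show ?thesis using i by simp
  qed
  have fino: "finite (orbits G E \<phi>)"
    using fin orbits_coverture finite_UnionD by metis
  have "card E = (\<Sum>O'\<in>orbits G E \<phi>. card O')"
    using disjoint_sum[OF fin, of "\<lambda>_. 1::nat"] by simp
  also have "\<dots> = 1 + (\<Sum>O'\<in>orbits G E \<phi> - {{x}}. card O')"
    using sum.remove[OF fino xo, of card] by simp
  finally have "p dvd 1 + (\<Sum>O'\<in>orbits G E \<phi> - {{x}}. card O')" using dvd by simp
  moreover have "p dvd (\<Sum>O'\<in>orbits G E \<phi> - {{x}}. card O')"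
    using other by (rule dvd_sum)
  ultimately have "p dvd 1" by (metis dvd_add_left_iff)
  then show False using p by (simp add: prime_nat_iff)
qed

text \<open>The inverse turns right multiplication of right cosets into a left action. The
  restriction to \<open>rcosets M\<close> is there because elements of \<open>BijGroup\<close> are
  extensional.\<close>

lemma (in group) coset_action:
  assumes M: "subgroup M G"
  shows "group_action (G\<lparr>carrier := M\<rparr>) (rcosets M) (\<lambda>m. \<lambda>C\<in>rcosets M. C #> inv m)"
proof -
  let ?a = "\<lambda>m. \<lambda>C\<in>rcosets M. C #> inv m"
  have Mc: "M \<subseteq> carrier G" using M by (rule subgroup.subset)
  have sub: "C \<subseteq> carrier G" if "C \<in> rcosets M" for C
    using that M rcosets_part_G by blast
  have clos: "C #> g \<in> rcosets M" if C: "C \<in> rcosets M" and g: "g \<in> carrier G" for C g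
  proof -
    obtain a where "a \<in> carrier G" "C = M #> a" using C by (auto simp: RCOSETS_def)
    then have "C #> g = M #> (a \<otimes> g)" using coset_mult_assoc[OF Mc] g by simp
    then show ?thesis using rcosetsI[OF Mc] \<open>a \<in> carrier G\<close> g by simp
  qed
  have inv1: "(C #> g) #> inv g = C" "(C #> inv g) #> g = C" if "C \<in> rcosets M" "g \<in> carrier G" for C g
    using that sub by (simp_all add: coset_mult_assoc coset_mult_one)
  have bij: "?a m \<in> Bij (rcosets M)" if "m \<in> M" for m
  proof -
    have m: "m \<in> carrier G" using that Mc by blast
    have "bij_betw (?a m) (rcosets M) (rcosets M)"
      by (rule bij_betw_byWitness[where f' = "\<lambda>C. C #> m"]) (use m clos inv1 in auto)
    then show ?thesis by (simp add: Bij_def)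
  qed
  have "?a \<in> hom (G\<lparr>carrier := M\<rparr>) (BijGroup (rcosets M))"
  proof (rule homI)
    show "?a m \<in> carrier (BijGroup (rcosets M))" if "m \<in> carrier (G\<lparr>carrier := M\<rparr>)" for m
      using bij that by (simp add: BijGroup_def)
  next
    fix m n assume "m \<in> carrier (G\<lparr>carrier := M\<rparr>)" "n \<in> carrier (G\<lparr>carrier := M\<rparr>)"
    then have mn: "m \<in> M" "n \<in> M" "m \<in> carrier G" "n \<in> carrier G" using Mc by auto
    have "?a (m \<otimes> n) = compose (rcosets M) (?a m) (?a n)"
      using mn clos sub by (auto simp: compose_def restrict_def inv_mult_group coset_mult_assoc fun_eq_iff)
    then show "?a (m \<otimes>\<^bsub>G\<lparr>carrier := M\<rparr>\<^esub> n) = ?a m \<otimes>\<^bsub>BijGroup (rcosets M)\<^esub> ?a n"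
      using bij mn by (simp add: BijGroup_def)
  qed
  then show ?thesis
    using subgroup.subgroup_is_group[OF M group_axioms] group_BijGroup
    by (simp add: group_action_def group_hom_def group_hom_axioms_def)
qed

lemma (in group) card_subgroup_prime_power:
  assumes "prime p" "order G = p ^ k" "subgroup H G"
  shows "\<exists>i. card H = p ^ i" "\<exists>i. card (rcosets H) = p ^ i"
proof -
  have "card (rcosets H) * card H = p ^ k" using lagrange assms by simp
  then have "card (rcosets H) dvd p ^ k" "card H dvd p ^ k" by (metis dvd_triv_left, metis dvd_triv_right)
  then show "\<exists>i. card H = p ^ i" "\<exists>i. card (rcosets H) = p ^ i"
    using divides_primepow_nat[OF assms(1)] by blast+
qed

text \<open>Normalizers grow in p-groups. \<open>M\<close> acts on its right cosets and fixes the
  coset \<open>M\<close>; their number is divisible by \<open>p\<close>, so a second coset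
  \<open>M #> g\<close> is fixed, and \<open>M #> (g \<otimes> m) = M #> g\<close> says that
  \<open>g\<close> conjugates \<open>m\<close> into \<open>M\<close>.\<close>

lemma (in group) normalizing_element_outside:
  assumes p: "prime p" and ord: "order G = p ^ k" and M: "subgroup M G" and ne: "M \<noteq> carrier G"
  shows "\<exists>g\<in>carrier G - M. \<forall>m\<in>M. g \<otimes> m \<otimes> inv g \<in> M"
proof -
  let ?a = "\<lambda>m. \<lambda>C\<in>rcosets M. C #> inv m"
  interpret act: group_action "G\<lparr>carrier := M\<rparr>" "rcosets M" ?a by (rule coset_action[OF M])
  have Mc: "M \<subseteq> carrier G" using M by (rule subgroup.subset)
  have fin: "finite (carrier G)"
    using ord p by (metis order_gt_0_iff_finite prime_gt_0_nat zero_less_power)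
  obtain i where i: "card M = p ^ i" using card_subgroup_prime_power[OF p ord M] by blast
  obtain j where j: "card (rcosets M) = p ^ j" using card_subgroup_prime_power[OF p ord M] by blast
  have "j \<noteq> 0"
  proof
    assume "j = 0"
    then have "card M = card (carrier G)" using lagrange[OF M] j by (simp add: order_def)
    then show False using card_subset_eq[OF fin Mc] ne by simp
  qed
  then have "p dvd card (rcosets M)" using j by simp
  moreover have "order (G\<lparr>carrier := M\<rparr>) = p ^ i" using i by (simp add: order_def)
  moreover have "finite (rcosets M)"
    using fin by (auto simp: RCOSETS_def)
  moreover have Mr: "M \<in> rcosets M" using subgroup.subgroup_in_rcosets[OF M group_axioms] .
  moreover have "?a m M = M" if "m \<in> carrier (G\<lparr>carrier := M\<rparr>)" for m
  proof -
    have "inv m \<in> M" using that M by (simp add: subgroup.m_inv_closed)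
    then show ?thesis using Mr subgroup.rcos_const[OF M group_axioms] by simp
  qed
  ultimately obtain C where C: "C \<in> rcosets M" "C \<noteq> M" "\<forall>m\<in>M. ?a m C = C"
    using act.another_fixed_point[OF p, of i M] by auto
  obtain g where g: "g \<in> carrier G" "C = M #> g" using C(1) by (auto simp: RCOSETS_def)
  have "g \<notin> M" using C(2) g(2) subgroup.rcos_const[OF M group_axioms] by auto
  moreover have "g \<otimes> m \<otimes> inv g \<in> M" if "m \<in> M" for m
  proof -
    have m: "m \<in> carrier G" "inv m \<in> M" using that Mc M by (auto simp: subgroup.m_inv_closed)
    have "C #> m = C" using C(1,3) m by (metis inv_inv restrict_apply')
    then have "M #> (g \<otimes> m) = M #> g" using g m Mc by (simp add: coset_mult_assoc)
    then show ?thesis using repr_independenceD g m M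
      by (metis subgroup.rcos_module m_closed rcos_self is_group)
  qed
  ultimately show ?thesis using g(1) by blast
qed

text \<open>A maximal proper subgroup above \<open>H\<close> is strictly smaller than its
  normalizer, which by maximality is the whole group.\<close>

lemma (in group) proper_subgroup_in_normal:
  assumes p: "prime p" and ord: "order G = p ^ k" and H: "subgroup H G" and ne: "H \<noteq> carrier G"
  shows "\<exists>M. M \<lhd> G \<and> H \<subseteq> M \<and> M \<noteq> carrier G \<and>
           (\<forall>K. subgroup K G \<and> M \<subseteq> K \<longrightarrow> K = M \<or> K = carrier G)"
proof -
  have fin: "finite (carrier G)"
    using ord p by (metis order_gt_0_iff_finite prime_gt_0_nat zero_less_power)
  let ?S = "{K. subgroup K G \<and> H \<subseteq> K \<and> K \<noteq> carrier G}"
  have "?S \<subseteq> Pow (carrier G)" by (auto dest: subgroup.subset)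
  from finite_subset[OF this] have "finite ?S" using fin by simp
  moreover have "H \<in> ?S" using H ne by blast
  ultimately obtain M where M: "M \<in> ?S" and max: "\<And>K. K \<in> ?S \<Longrightarrow> M \<subseteq> K \<Longrightarrow> M = K"
    using finite_has_maximal2[of ?S H] by (metis (no_types, lifting))
  have Ms: "subgroup M G" and Mc: "M \<subseteq> carrier G" using M subgroup.subset by auto
  \<comment> \<open>Only an inclusion is demanded here, matching what the previous lemma delivers.
    Finiteness turns it into the equality that closure under inverses requires.\<close>
  let ?N = "{g \<in> carrier G. (\<lambda>m. g \<otimes> m \<otimes> inv g) ` M \<subseteq> M}"
  have surj: "(\<lambda>m. g \<otimes> m \<otimes> inv g) ` M = M" if "g \<in> ?N" for g
  proof (rule card_subset_eq)
    show "finite M" using fin Mc finite_subset by blast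
    show "card ((\<lambda>m. g \<otimes> m \<otimes> inv g) ` M) = card M"
    proof (rule card_image, rule inj_onI)
      fix x y assume xy: "x \<in> M" "y \<in> M" "g \<otimes> x \<otimes> inv g = g \<otimes> y \<otimes> inv g"
      have "x \<in> carrier G" "y \<in> carrier G" "g \<in> carrier G" using xy Mc that by auto
      then show "x = y" using xy(3) by (simp add: m_assoc)
    qed
  qed (use that in blast)
  have "subgroup ?N G"
  proof (rule subgroupI)
    show "?N \<noteq> {}" using Mc by (auto intro!: exI[of _ \<one>])
  next
    fix g assume g: "g \<in> ?N"
    have "inv g \<otimes> m \<otimes> inv (inv g) \<in> M" if m: "m \<in> M" for m
    proof -
      obtain m' where m': "m' \<in> M" "m = g \<otimes> m' \<otimes> inv g" using surj[OF g] m by blast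
      have "inv g \<otimes> m \<otimes> inv (inv g) = m'"
        using m'(2) subsetD[OF Mc m'(1)] conjunct1[OF CollectD[OF g]]
        by (simp add: m_assoc inv_cancel_assoc)
      then show ?thesis using m' by simp
    qed
    then show "inv g \<in> ?N" using g by auto
  next
    fix g h assume gh: "g \<in> ?N" "h \<in> ?N"
    have "g \<otimes> h \<otimes> m \<otimes> inv (g \<otimes> h) \<in> M" if m: "m \<in> M" for m
    proof -
      have "g \<otimes> h \<otimes> m \<otimes> inv (g \<otimes> h) = g \<otimes> (h \<otimes> m \<otimes> inv h) \<otimes> inv g"
        using subsetD[OF Mc m] conjunct1[OF CollectD[OF gh(1)]] conjunct1[OF CollectD[OF gh(2)]]
        by (simp add: m_assoc inv_mult_group)
      then show ?thesis using gh m by blast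
    qed
    then show "g \<otimes> h \<in> ?N" using gh by auto
  qed auto
  moreover have "M \<subseteq> ?N"
    using Ms Mc by (auto intro!: subgroup.m_closed subgroup.m_inv_closed)
  moreover obtain g where "g \<in> carrier G - M" "\<forall>m\<in>M. g \<otimes> m \<otimes> inv g \<in> M"
    using normalizing_element_outside[OF p ord Ms] M by blast
  moreover from this have "g \<in> ?N" by blast
  ultimately have N: "?N = carrier G" using max[of ?N] M by blast
  then have "M \<lhd> G" using Ms by (subst normal_inv_iff) blast
  moreover have "K = M \<or> K = carrier G" if "subgroup K G" "M \<subseteq> K" for K
    using max[of K] that M by blast
  ultimately show ?thesis using M by blast
qed

lemma (in normal) quotient_pow_mem:
  assumes x: "x \<in> carrier G" and m: "int (group.ord (G Mod H) (H #> x)) dvd m"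
  shows "x [^] m \<in> H"
proof -
  interpret Q: group "G Mod H" by (rule factorgroup_is_group)
  have "H #> x \<in> carrier (G Mod H)" using x by (simp add: carrier_FactGroup)
  then have "(H #> x) [^]\<^bsub>G Mod H\<^esub> m = \<one>\<^bsub>G Mod H\<^esub>" using m using Q.int_pow_eq_id by blast
  then have "H #> x [^] m = H" using x FactGroup_int_pow by simp
  then show ?thesis using x by (metis int_pow_closed rcos_self subgroup_axioms)
qed

text \<open>For a maximal (hence normal) proper subgroup \<open>M\<close> above \<open>H\<close> and \<open>y \<notin> M\<close> with
  \<open>y ^ p \<in> M\<close>, the character sends \<open>m y ^ j\<close> to \<open>j\<close>.\<close>

lemma (in group) p_group_character:
  assumes p: "prime p" and ord: "order G = p ^ k" and H: "subgroup H G" and ne: "H \<noteq> carrier G"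
  shows "\<exists>\<chi>::'a \<Rightarrow> int. (\<forall>x\<in>carrier G. \<forall>y\<in>carrier G. [\<chi> (x \<otimes> y) = \<chi> x + \<chi> y] (mod int p)) \<and>
           (\<forall>x\<in>H. int p dvd \<chi> x) \<and> (\<exists>x\<in>carrier G. \<not> int p dvd \<chi> x)"
proof -
  obtain M where M: "M \<lhd> G" "H \<subseteq> M" "M \<noteq> carrier G"
    and max: "\<And>K. subgroup K G \<Longrightarrow> M \<subseteq> K \<Longrightarrow> K = M \<or> K = carrier G"
    using proper_subgroup_in_normal[OF assms] by (elim exE conjE) (rule that, auto)
  interpret M: normal M G by (rule M(1))
  have Mc: "M \<subseteq> carrier G" by (rule M.subset)
  interpret Q: group "G Mod M" by (rule M.factorgroup_is_group)
  obtain z where z: "z \<in> carrier G" "z \<notin> M" using M(3) Mc by blast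
  have zQ: "M #> z \<in> carrier (G Mod M)" using z by (simp add: carrier_FactGroup)
  obtain j where j: "card (rcosets M) = p ^ j"
    using card_subgroup_prime_power[OF p ord M.subgroup_axioms] by blast
  have "order (G Mod M) = p ^ j" using j by (simp add: order_def FactGroup_def)
  then have "Q.ord (M #> z) dvd p ^ j" using Q.ord_dvd_group_order[OF zQ] by simp
  then obtain i where i: "Q.ord (M #> z) = p ^ i" using divides_primepow_nat[OF p] by blast
  have "z [^] int (p ^ i) \<in> M" by (rule M.quotient_pow_mem[OF z(1)]) (simp add: i)
  then have ex: "\<exists>n. z [^] (p ^ n) \<in> M" by (metis int_pow_int)
  \<comment> \<open>By minimality the preceding power \<open>y\<close> of \<open>z\<close> is still
    outside \<open>M\<close> while \<open>y [^] p\<close> is inside. The exponent is positive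
    because \<open>z \<notin> M\<close>.\<close>
  define n where "n = (LEAST n. z [^] (p ^ n) \<in> M)"
  have n: "z [^] (p ^ n) \<in> M" unfolding n_def using ex by (rule LeastI_ex)
  have "n \<noteq> 0" using n z by (cases n) auto
  then obtain n' where n': "n = Suc n'" by (cases n) auto
  define y where "y = z [^] (p ^ n')"
  have y: "y \<in> carrier G" "y \<notin> M"
    using z not_less_Least[of n' "\<lambda>n. z [^] (p ^ n) \<in> M"] n' by (auto simp: y_def n_def)
  have yp: "y [^] p \<in> M" using n z by (simp add: y_def n' nat_pow_pow mult.commute)
  \<comment> \<open>For an exponent \<open>c\<close> prime to \<open>p\<close>, Bezout writes
    \<open>y\<close> as a product of powers of \<open>y [^] p\<close> and \<open>y [^] c\<close>,
    which would put \<open>y\<close> into \<open>M\<close>.\<close>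
  have powM: "y [^] (c::int) \<in> M \<longleftrightarrow> int p dvd c" for c
  proof
    assume "int p dvd c"
    then obtain d where "c = int p * d" by blast
    then have "y [^] c = (y [^] p) [^] d" using y by (simp add: int_pow_pow flip: int_pow_int)
    then show "y [^] c \<in> M" using yp by (simp add: M.subgroup_axioms subgroup_int_pow_closed)
  next
    assume c: "y [^] c \<in> M"
    show "int p dvd c"
    proof (rule ccontr)
      assume "\<not> int p dvd c"
      then have "coprime (int p) c" using p by (simp add: prime_imp_coprime)
      then obtain a b where ab: "a * int p + b * c = 1"
        using bezout_int[of "int p" c] by (auto simp: coprime_iff_gcd_eq_1)
      have "y = y [^] (int p * a + c * b)" using y ab by (simp add: mult.commute)
      also have "\<dots> = (y [^] p) [^] a \<otimes> (y [^] c) [^] b"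
        using y by (simp add: int_pow_mult int_pow_pow flip: int_pow_int)
      also have "\<dots> \<in> M"
        using yp c by (simp add: M.subgroup_axioms subgroup_int_pow_closed)
      finally show False using y by simp
    qed
  qed
  \<comment> \<open>The product of \<open>M\<close> with the cyclic group generated by
    \<open>y\<close>. Maximality of \<open>M\<close> makes it all of \<open>G\<close>, so every
    element has an exponent.\<close>
  let ?K = "{x \<in> carrier G. \<exists>j::int. x \<otimes> inv (y [^] j) \<in> M}"
  have comb: "(a \<otimes> b) \<otimes> inv (y [^] (j + l)) \<in> M"
    if "a \<in> carrier G" "b \<in> carrier G" "a \<otimes> inv (y [^] j) \<in> M" "b \<otimes> inv (y [^] l) \<in> M"
    for a b and j l :: int
  proof -
    let ?Y = "y [^] j" and ?Z = "y [^] l"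
    have Y: "?Y \<in> carrier G" "?Z \<in> carrier G" using y by auto
    have "?Y \<otimes> (b \<otimes> inv ?Z) \<otimes> inv ?Y \<in> M" using M.inv_op_closed2[OF Y(1) that(4)] .
    then have "(a \<otimes> inv ?Y) \<otimes> (?Y \<otimes> (b \<otimes> inv ?Z) \<otimes> inv ?Y) \<in> M" using that(3) by (rule M.m_closed[rotated])
    moreover have "(a \<otimes> inv ?Y) \<otimes> (?Y \<otimes> (b \<otimes> inv ?Z) \<otimes> inv ?Y) = a \<otimes> b \<otimes> inv (?Y \<otimes> ?Z)"
      using that Y by (simp add: m_assoc inv_mult_group inv_cancel_assoc)
    ultimately show ?thesis using y by (simp add: int_pow_mult)
  qed
  have uniq: "int p dvd j - l" if "x \<in> carrier G" "x \<otimes> inv (y [^] j) \<in> M" "x \<otimes> inv (y [^] l) \<in> M"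
    for x and j l :: int
  proof -
    let ?Y = "y [^] j" and ?Z = "y [^] l"
    have Y: "?Y \<in> carrier G" "?Z \<in> carrier G" using y by auto
    have "inv (x \<otimes> inv ?Y) \<otimes> (x \<otimes> inv ?Z) \<in> M" using that by blast
    moreover have "inv (x \<otimes> inv ?Y) \<otimes> (x \<otimes> inv ?Z) = ?Y \<otimes> inv ?Z"
      using that(1) Y by (simp add: m_assoc inv_mult_group inv_cancel_assoc)
    ultimately have "y [^] (j - l) \<in> M" using y by (simp add: int_pow_diff)
    then show ?thesis using powM by simp
  qed
  have "subgroup ?K G"
  proof (rule subgroupI)
    show "?K \<noteq> {}" by (auto intro!: exI[of _ \<one>] exI[of _ "0::int"])
  next
    fix a assume "a \<in> ?K"
    then obtain j :: int where a: "a \<in> carrier G" "a \<otimes> inv (y [^] j) \<in> M" by blast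
    let ?Y = "y [^] j"
    have Y: "?Y \<in> carrier G" using y by auto
    have "inv a \<otimes> inv (a \<otimes> inv ?Y) \<otimes> inv (inv a) \<in> M"
      using a M.inv_op_closed2[of "inv a"] by blast
    moreover have "inv a \<otimes> inv (a \<otimes> inv ?Y) \<otimes> inv (inv a) = inv a \<otimes> inv (y [^] (- j))"
      using a Y y by (simp add: m_assoc inv_mult_group int_pow_neg inv_cancel_assoc)
    ultimately have "inv a \<otimes> inv (y [^] (- j)) \<in> M" by simp
    then show "inv a \<in> ?K" using a(1) by blast
  next
    fix a b assume "a \<in> ?K" "b \<in> ?K"
    then obtain j l :: int where "a \<in> carrier G" "a \<otimes> inv (y [^] j) \<in> M" "b \<in> carrier G" "b \<otimes> inv (y [^] l) \<in> M" by blast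
    then show "a \<otimes> b \<in> ?K" using comb[of a b j l] by blast
  qed auto
  moreover have "M \<subseteq> ?K" using Mc by (auto intro!: exI[of _ "0::int"])
  moreover have "y \<in> ?K" using y by (auto intro!: exI[of _ "1::int"])
  ultimately have K: "?K = carrier G" using max[of ?K] y by blast
  \<comment> \<open>The exponent is determined only modulo \<open>p\<close>, by \<open>uniq\<close>;
    an arbitrary choice is enough because additivity is claimed modulo \<open>p\<close>.\<close>
  define \<chi> where "\<chi> x = (SOME j::int. x \<otimes> inv (y [^] j) \<in> M)" for x
  have \<chi>: "x \<otimes> inv (y [^] \<chi> x) \<in> M" if "x \<in> carrier G" for x
    unfolding \<chi>_def by (rule someI_ex) (use K that in blast)
  have "[\<chi> (a \<otimes> b) = \<chi> a + \<chi> b] (mod int p)" if "a \<in> carrier G" "b \<in> carrier G" for a b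
    unfolding cong_iff_dvd_diff
    by (rule uniq[of "a \<otimes> b"]) (use that \<chi> comb in auto)
  moreover have "int p dvd \<chi> x" if "x \<in> H" for x
    using uniq[of x "\<chi> x" 0] \<chi>[of x] that M(2) Mc by auto
  moreover have "\<not> int p dvd \<chi> y"
  proof
    assume "int p dvd \<chi> y"
    moreover have "int p dvd \<chi> y - 1" using uniq[of y "\<chi> y" 1] \<chi>[of y] y by simp
    ultimately have "int p dvd 1" using dvd_diff[of "int p" "\<chi> y" "\<chi> y - 1"] by simp
    then show False using p by (simp add: prime_nat_iff)
  qed
  ultimately show ?thesis using y(1) by blast
qed

subsection \<open>Open subgroups of topological groups\<close>

lemma (in group) rcos_eq_iff:
  assumes "subgroup N G" "x \<in> carrier G" "y \<in> carrier G"
  shows "N #> x = N #> y \<longleftrightarrow> x \<otimes> inv y \<in> N"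
  using assms subgroup.rcos_module[OF assms(1) is_group, of y x]
  by (metis rcos_self repr_independence)

text \<open>Serves to show that an infinite family of maps yields only finitely many open sets
  \<open>A f\<close>, each determined by the finite data \<open>r f\<close>; their intersection is
  then open.\<close>

lemma finite_image_factor:
  assumes fin: "finite (r ` S)" and eq: "\<And>f g. f \<in> S \<Longrightarrow> g \<in> S \<Longrightarrow> r f = r g \<Longrightarrow> A f = A g"
  shows "finite (A ` S)"
proof -
  have "A f = A (inv_into S r (r f))" if "f \<in> S" for f
    using that by (intro eq) (auto intro: inv_into_into simp: f_inv_into_f)
  then have "A ` S \<subseteq> (\<lambda>c. A (inv_into S r c)) ` (r ` S)" by blast
  then show ?thesis using fin finite_surj by blast
qed

lemma decreasing_finite_stabilizes:
  fixes A :: "nat \<Rightarrow> 'c set"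
  assumes fin: "finite (A 0)" and dec: "\<And>n. A (Suc n) \<subseteq> A n"
  shows "\<exists>n. A (Suc n) = A n"
proof (rule ccontr)
  assume ne: "\<nexists>n. A (Suc n) = A n"
  have finA: "finite (A n)" for n by (induction n) (use fin dec finite_subset in blast)+
  have "card (A n) + n \<le> card (A 0)" for n
  proof (induction n)
    case (Suc n)
    have "card (A (Suc n)) < card (A n)" using ne dec finA by (metis psubsetI psubset_card_mono)
    then show ?case using Suc by simp
  qed simp
  from this[of "Suc (card (A 0))"] show False by simp
qed

text \<open>Pigeonhole for the self-map that \<open>f\<close> induces on the finite set of cosets.
  It yields both the injectivity of surjective endomorphisms and a kernel element modulo the
  Frattini subgroup for a non-surjective one.\<close>

lemma (in group) surj_mod_iff_inj_mod:
  assumes N: "subgroup N G" and fin: "finite (rcosets N)" and f: "f \<in> hom G G" and fN: "f ` N \<subseteq> N"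
  shows "(\<forall>y\<in>carrier G. \<exists>x\<in>carrier G. N #> f x = N #> y) \<longleftrightarrow> (\<forall>x\<in>carrier G. f x \<in> N \<longrightarrow> x \<in> N)"
proof -
  interpret f: group_hom G G f using f by unfold_locales
  let ?r = "\<lambda>C. SOME x. x \<in> carrier G \<and> C = N #> x"
  define F where "F C = N #> f (?r C)" for C
  have F_coset: "F (N #> x) = N #> f x" if x: "x \<in> carrier G" for x
  proof -
    let ?y = "?r (N #> x)"
    have y: "?y \<in> carrier G \<and> N #> x = N #> ?y" by (rule someI[of _ x]) (use x in simp)
    then have "?y \<otimes> inv x \<in> N" using rcos_eq_iff[OF N] x by metis
    then have "f (?y \<otimes> inv x) \<in> N" using fN by blast
    then show ?thesis using y x rcos_eq_iff[OF N] by (simp add: F_def)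
  qed
  have rc: "rcosets N = (\<lambda>x. N #> x) ` carrier G" by (auto simp: RCOSETS_def)
  have sub: "F ` (rcosets N) \<subseteq> rcosets N" using F_coset by (auto simp: rc)
  have "(\<forall>y\<in>carrier G. \<exists>x\<in>carrier G. N #> f x = N #> y) \<longleftrightarrow> F ` (rcosets N) = rcosets N"
  proof
    assume "\<forall>y\<in>carrier G. \<exists>x\<in>carrier G. N #> f x = N #> y"
    then have "rcosets N \<subseteq> F ` (rcosets N)" using F_coset unfolding rc by (force simp: image_iff)
    then show "F ` (rcosets N) = rcosets N" using sub by blast
  next
    assume eq: "F ` (rcosets N) = rcosets N"
    show "\<forall>y\<in>carrier G. \<exists>x\<in>carrier G. N #> f x = N #> y"
    proof
      fix y assume "y \<in> carrier G"
      then have "N #> y \<in> F ` (rcosets N)" using eq rc by blast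
      then obtain x where "x \<in> carrier G" "N #> y = F (N #> x)" unfolding rc by blast
      then show "\<exists>x\<in>carrier G. N #> f x = N #> y" using F_coset by auto
    qed
  qed
  also have "\<dots> \<longleftrightarrow> inj_on F (rcosets N)"
    using sub fin endo_inj_surj finite_surj_inj by (metis subset_refl)
  also have "\<dots> \<longleftrightarrow> (\<forall>x\<in>carrier G. f x \<in> N \<longrightarrow> x \<in> N)"
  proof
    assume inj: "inj_on F (rcosets N)"
    show "\<forall>x\<in>carrier G. f x \<in> N \<longrightarrow> x \<in> N"
    proof (intro ballI impI)
      fix x assume x: "x \<in> carrier G" "f x \<in> N"
      then have "F (N #> x) = F (N #> \<one>)"
        using F_coset[of x] F_coset[of \<one>] rcos_eq_iff[OF N, of "f x" \<one>] by simp
      then have "N #> x = N #> \<one>" using inj x(1) unfolding inj_on_def rc by blast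
      then show "x \<in> N" using rcos_eq_iff[OF N, of x \<one>] x by simp
    qed
  next
    assume inj: "\<forall>x\<in>carrier G. f x \<in> N \<longrightarrow> x \<in> N"
    show "inj_on F (rcosets N)"
    proof (rule inj_onI)
      fix C D assume CD: "C \<in> rcosets N" "D \<in> rcosets N" "F C = F D"
      then obtain x y where xy: "x \<in> carrier G" "y \<in> carrier G" "C = N #> x" "D = N #> y"
        unfolding rc by blast
      then have "f x \<otimes> inv (f y) \<in> N" using CD(3) F_coset rcos_eq_iff[OF N] by simp
      then have "f (x \<otimes> inv y) \<in> N" using xy by simp
      then have "x \<otimes> inv y \<in> N" using inj xy by blast
      then show "C = D" using xy rcos_eq_iff[OF N] by simp
    qed
  qed
  finally show ?thesis .
qed

locale top_group =
  fixes G (structure) and T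
  assumes top_group: "topological_group G T"

sublocale top_group \<subseteq> group G
  using top_group by (simp add: topological_group_def)

context top_group
begin

lemma topspace_eq [simp]: "topspace T = carrier G"
  using top_group by (simp add: topological_group_def)

lemma openin_carrier [simp]: "openin T (carrier G)"
  by (metis openin_topspace topspace_eq)

lemma openin_imp_subset: "openin T U \<Longrightarrow> U \<subseteq> carrier G"
  using openin_subset by fastforce

lemma continuous_map_mult:
  assumes "continuous_map S T f" "continuous_map S T g"
  shows "continuous_map S T (\<lambda>x. f x \<otimes> g x)"
proof -
  have "continuous_map S (prod_topology T T) (\<lambda>x. (f x, g x))"
    using assms by (rule continuous_map_pairedI)
  then have "continuous_map S T ((\<lambda>(x, y). x \<otimes> y) \<circ> (\<lambda>x. (f x, g x)))"
    by (rule continuous_map_compose) (use top_group in \<open>simp add: topological_group_def\<close>)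
  then show ?thesis by (simp add: o_def)
qed

lemma openin_preimage:
  assumes "continuous_map T S f" "openin S U"
  shows "openin T {x \<in> carrier G. f x \<in> U}"
  using openin_continuous_map_preimage[OF assms] by simp

lemma openin_translate:
  assumes "openin T U" "a \<in> carrier G"
  shows "openin T {x \<in> carrier G. x \<otimes> a \<in> U}" "openin T {x \<in> carrier G. a \<otimes> x \<in> U}"
  using assms by (auto intro!: openin_preimage[OF _ assms(1)] continuous_map_mult)

text \<open>\<open>A\<close> is a union of right cosets of \<open>N\<close>, each open as the
  preimage of \<open>N\<close> under a right translation.\<close>

lemma openin_if_coset_closed:
  assumes N: "subgroup N G" "openin T N" and A: "A \<subseteq> carrier G"
    and closed: "\<And>n a. n \<in> N \<Longrightarrow> a \<in> A \<Longrightarrow> n \<otimes> a \<in> A"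
  shows "openin T A"
proof (subst openin_subopen, intro ballI)
  fix a assume a: "a \<in> A"
  let ?U = "{x \<in> carrier G. x \<otimes> inv a \<in> N}"
  have "openin T ?U" using N a A by (auto intro: openin_translate)
  moreover have "a \<in> ?U" using a A subgroup.one_closed[OF N(1)] by auto
  moreover have "?U \<subseteq> A"
  proof
    fix x assume x: "x \<in> ?U"
    then have "(x \<otimes> inv a) \<otimes> a \<in> A" using closed a by blast
    then show "x \<in> A" using x a A by (simp add: m_assoc subset_iff)
  qed
  ultimately show "\<exists>U. openin T U \<and> a \<in> U \<and> U \<subseteq> A" by blast
qed

lemma openin_coset_function:
  assumes N: "subgroup N G" "openin T N"
    and f: "\<And>n x. n \<in> N \<Longrightarrow> x \<in> carrier G \<Longrightarrow> f (n \<otimes> x) = f x"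
  shows "openin T {x \<in> carrier G. f x \<in> A}"
  by (rule openin_if_coset_closed[OF N]) (use f subgroup.subset[OF N(1)] in auto)

lemma openin_subgroup_mono:
  assumes "subgroup N G" "openin T N" "subgroup H G" "N \<subseteq> H"
  shows "openin T H"
  by (rule openin_if_coset_closed[OF assms(1,2)])
     (use assms in \<open>auto intro: subgroup.m_closed dest: subgroup.subset\<close>)

lemma closedin_open_subgroup:
  assumes N: "subgroup N G" "openin T N"
  shows "closedin T N"
proof -
  have "openin T (carrier G - N)"
  proof (rule openin_if_coset_closed[OF N])
    fix n a assume na: "n \<in> N" "a \<in> carrier G - N"
    have n: "n \<in> carrier G" using na(1) subgroup.subset[OF N(1)] by blast
    have "a \<in> N" if "n \<otimes> a \<in> N"
    proof -
      have "inv n \<otimes> (n \<otimes> a) \<in> N" using that na(1) N(1) by (simp add: subgroup.m_closed subgroup.m_inv_closed)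
      then show ?thesis using n na(2) by (simp add: inv_cancel_assoc)
    qed
    then show "n \<otimes> a \<in> carrier G - N" using na n by auto
  qed auto
  then show ?thesis using subgroup.subset[OF N(1)] by (simp add: closedin_def)
qed

text \<open>The cosets are a disjoint open cover, so a finite subcover already contains all of
  them.\<close>

lemma finite_rcosets:
  assumes comp: "compact_space T" and N: "subgroup N G" "openin T N"
  shows "finite (rcosets N)"
proof -
  have "openin T C" if "C \<in> rcosets N" for C
  proof -
    obtain a where a: "a \<in> carrier G" "C = N #> a" using \<open>C \<in> rcosets N\<close> by (auto simp: RCOSETS_def)
    show ?thesis
    proof (rule openin_if_coset_closed[OF N])
      show "C \<subseteq> carrier G" using a N subgroup.subset r_coset_subset_G by blast
      fix n c assume "n \<in> N" "c \<in> C"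
      then obtain m where "m \<in> N" "c = m \<otimes> a" using a(2) by (auto simp: r_coset_def)
      moreover have "n \<otimes> (m \<otimes> a) = (n \<otimes> m) \<otimes> a"
        using \<open>n \<in> N\<close> \<open>m \<in> N\<close> a(1) subgroup.subset[OF N(1)] by (simp add: m_assoc subset_iff)
      ultimately show "n \<otimes> c \<in> C" using a(2) \<open>n \<in> N\<close> N(1)
        by (auto simp: r_coset_def intro!: bexI[of _ "n \<otimes> m"] subgroup.m_closed)
    qed
  qed
  moreover have un: "\<Union>(rcosets N) = topspace T" using rcosets_part_G[OF N(1)] by simp
  ultimately obtain \<F> where F: "finite \<F>" "\<F> \<subseteq> rcosets N" "\<Union>\<F> = topspace T"
    using comp[unfolded compact_space] by meson
  have "C \<in> \<F>" if C: "C \<in> rcosets N" for C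
  proof -
    obtain c where c: "c \<in> C" using subgroup.rcosets_non_empty[OF N(1) C] by blast
    then obtain D where D: "D \<in> \<F>" "c \<in> D" using F(3) un C by blast
    then have "C = D" using rcos_disjoint[OF N(1)] C c F(2) by (auto simp: pairwise_def disjnt_def)
    then show ?thesis using D by simp
  qed
  then show ?thesis by (intro finite_subset[OF _ F(1)] subsetI)
qed

text \<open>The conjugate \<open>?A g\<close> depends only on the coset \<open>H #> g\<close>.
  Finite index leaves finitely many conjugates, and their intersection is open and normal.\<close>

lemma open_normal_core:
  assumes comp: "compact_space T" and H: "subgroup H G" "openin T H"
  shows "\<exists>N. N \<lhd> G \<and> openin T N \<and> N \<subseteq> H"
proof -
  let ?A = "\<lambda>g. {x \<in> carrier G. g \<otimes> x \<otimes> inv g \<in> H}"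
  let ?N = "\<Inter>g\<in>carrier G. ?A g"
  have Hc: "H \<subseteq> carrier G" using H(1) by (rule subgroup.subset)
  have conj1: "h \<otimes> x \<otimes> inv h \<in> H" if "h \<in> H" "x \<in> H" for h x
    using that H(1) by (simp add: subgroup.m_closed subgroup.m_inv_closed)
  have mono: "?A g \<subseteq> ?A g'" if g: "g \<in> carrier G" "g' \<in> carrier G" "H #> g = H #> g'" for g g'
  proof
    fix x assume x: "x \<in> ?A g"
    have h: "g' \<otimes> inv g \<in> H" using g rcos_eq_iff[OF H(1)] by metis
    have "(g' \<otimes> inv g) \<otimes> (g \<otimes> x \<otimes> inv g) \<otimes> inv (g' \<otimes> inv g) \<in> H"
      using conj1[OF h] x by blast
    moreover have "(g' \<otimes> inv g) \<otimes> (g \<otimes> x \<otimes> inv g) \<otimes> inv (g' \<otimes> inv g) = g' \<otimes> x \<otimes> inv g'"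
      using g x by (simp add: m_assoc inv_mult_group inv_cancel_assoc)
    ultimately show "x \<in> ?A g'" using x by simp
  qed
  have "(\<lambda>g. H #> g) ` carrier G = rcosets H" by (auto simp: RCOSETS_def)
  then have "finite ((\<lambda>g. H #> g) ` carrier G)" using finite_rcosets[OF comp H] by simp
  then have "finite (?A ` carrier G)"
    by (rule finite_image_factor) (rule subset_antisym; rule mono; simp)
  moreover have "openin T (?A g)" if "g \<in> carrier G" for g
    using that by (intro openin_preimage[OF _ H(2)] continuous_map_mult) auto
  ultimately have "openin T (\<Inter>(?A ` carrier G))"
    using one_closed by (intro openin_Inter) blast+
  moreover have N: "x \<in> ?N \<longleftrightarrow> x \<in> carrier G \<and> (\<forall>g\<in>carrier G. g \<otimes> x \<otimes> inv g \<in> H)" for x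
    using one_closed by blast
  have "subgroup ?N G"
  proof (rule subgroupI)
    have "\<one> \<in> ?N" unfolding N using H(1) by (simp add: subgroup.one_closed)
    then show "?N \<noteq> {}" by blast
    show "?N \<subseteq> carrier G" using N by blast
  next
    fix a assume a: "a \<in> ?N"
    have "g \<otimes> inv a \<otimes> inv g \<in> H" if g: "g \<in> carrier G" for g
    proof -
      have "inv (g \<otimes> a \<otimes> inv g) \<in> H" using a g H(1) N by (meson subgroup.m_inv_closed)
      moreover have "inv (g \<otimes> a \<otimes> inv g) = g \<otimes> inv a \<otimes> inv g"
        using a g N by (simp add: inv_mult_group m_assoc)
      ultimately show ?thesis by simp
    qed
    then show "inv a \<in> ?N" using a unfolding N by simp
  next
    fix a b assume ab: "a \<in> ?N" "b \<in> ?N"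
    have "g \<otimes> (a \<otimes> b) \<otimes> inv g \<in> H" if g: "g \<in> carrier G" for g
    proof -
      have "(g \<otimes> a \<otimes> inv g) \<otimes> (g \<otimes> b \<otimes> inv g) \<in> H" using ab g H(1) N by (meson subgroup.m_closed)
      moreover have "(g \<otimes> a \<otimes> inv g) \<otimes> (g \<otimes> b \<otimes> inv g) = g \<otimes> (a \<otimes> b) \<otimes> inv g"
        using ab g N by (simp add: inv_cancel_assoc m_assoc)
      ultimately show ?thesis by simp
    qed
    then show "a \<otimes> b \<in> ?N" using ab unfolding N by simp
  qed
  moreover have "x \<otimes> h \<otimes> inv x \<in> ?N" if xh: "x \<in> carrier G" "h \<in> ?N" for x h
    unfolding N
  proof (intro conjI ballI)
    show "x \<otimes> h \<otimes> inv x \<in> carrier G" using xh N by simp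
    fix g assume g: "g \<in> carrier G"
    have "(g \<otimes> x) \<otimes> h \<otimes> inv (g \<otimes> x) \<in> H" using xh g N by blast
    then show "g \<otimes> (x \<otimes> h \<otimes> inv x) \<otimes> inv g \<in> H" using xh g N by (simp add: m_assoc inv_mult_group)
  qed
  moreover have "?N \<subseteq> H"
  proof
    fix x assume "x \<in> ?N"
    then have "x \<in> carrier G" "\<one> \<otimes> x \<otimes> inv \<one> \<in> H" using N one_closed by blast+
    then show "x \<in> H" by simp
  qed
  ultimately show ?thesis by (intro exI[of _ ?N]) (simp only: normal_inv_iff, blast)
qed

end

subsection \<open>Characters of pro-p groups\<close>

locale pro_p =
  fixes p :: nat and G (structure) and T
  assumes prime_p: "prime p" and pro_p: "pro_p_group p G T"

sublocale pro_p \<subseteq> top_group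
  using pro_p by unfold_locales (simp add: pro_p_group_def profinite_group_def)

context pro_p
begin

lemma compact: "compact_space T" and Hausdorff: "Hausdorff_space T"
  using pro_p by (simp_all add: pro_p_group_def profinite_group_def)

lemma open_normal_nbhd:
  assumes "openin T U" "\<one> \<in> U"
  shows "\<exists>N. N \<lhd> G \<and> openin T N \<and> N \<subseteq> U"
proof -
  obtain H where H: "subgroup H G" "openin T H" "H \<subseteq> U"
    using pro_p assms unfolding pro_p_group_def profinite_group_def by blast
  obtain N where N: "N \<lhd> G" "openin T N" "N \<subseteq> H"
    using open_normal_core[OF compact H(1,2)] by blast
  then show ?thesis using H(3) by blast
qed

lemma order_quotient:
  assumes "N \<lhd> G" "openin T N"
  shows "\<exists>k. order (G Mod N) = p ^ k"
proof -
  obtain k where "card (rcosets N) = p ^ k" using pro_p assms unfolding pro_p_group_def by blast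
  then show ?thesis by (auto simp: order_def FactGroup_def)
qed

lemma closedin_singleton: "x \<in> carrier G \<Longrightarrow> closedin T {x}"
  using Hausdorff by (simp add: Hausdorff_imp_t1_space closedin_t1_singleton)

text \<open>The conclusion says that the coset \<open>N #> x\<close> misses \<open>K\<close>. When
  \<open>K\<close> is a subgroup, this keeps \<open>x\<close> outside the image of \<open>K\<close>
  in the quotient by \<open>N\<close>.\<close>

lemma separate_from_closed:
  assumes K: "closedin T K" and x: "x \<in> carrier G" "x \<notin> K"
  shows "\<exists>N. N \<lhd> G \<and> openin T N \<and> (\<forall>n\<in>N. n \<otimes> x \<notin> K)"
proof -
  have "openin T (carrier G - K)" using K by (simp add: closedin_def)
  then have "openin T {y \<in> carrier G. y \<otimes> x \<in> carrier G - K}" using x(1) by (rule openin_translate)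
  moreover have "\<one> \<in> {y \<in> carrier G. y \<otimes> x \<in> carrier G - K}" using x by simp
  ultimately obtain N where "N \<lhd> G" "openin T N" "N \<subseteq> {y \<in> carrier G. y \<otimes> x \<in> carrier G - K}"
    using open_normal_nbhd by meson
  then show ?thesis by blast
qed

lemma separate_from_one:
  assumes "x \<in> carrier G" "x \<noteq> \<one>"
  shows "\<exists>N. N \<lhd> G \<and> openin T N \<and> x \<notin> N"
proof -
  obtain N where N: "N \<lhd> G" "openin T N" "\<forall>n\<in>N. n \<otimes> x \<notin> {\<one>}"
    using separate_from_closed[OF closedin_singleton[OF one_closed] assms(1)] assms(2) by blast
  have Ns: "subgroup N G" using N(1) by (rule normal_imp_subgroup)
  have "x \<notin> N"
  proof
    assume "x \<in> N"
    then have "inv x \<otimes> x \<notin> {\<one>}" using N(3) subgroup.m_inv_closed[OF Ns] by blast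
    then show False using assms(1) by simp
  qed
  then show ?thesis using N(1,2) by blast
qed

text \<open>Integer representatives of the continuous homomorphisms to the cyclic group of order
  \<open>p\<close>. Values matter only modulo \<open>p\<close>, and continuity is encoded by the
  open kernel.\<close>

definition characters :: "('a \<Rightarrow> int) set" where
  "characters = {\<chi>. (\<forall>x\<in>carrier G. \<forall>y\<in>carrier G. [\<chi> (x \<otimes> y) = \<chi> x + \<chi> y] (mod int p)) \<and>
     openin T {x \<in> carrier G. int p dvd \<chi> x}}"

lemma character_mult:
  assumes "\<chi> \<in> characters" "x \<in> carrier G" "y \<in> carrier G"
  shows "[\<chi> (x \<otimes> y) = \<chi> x + \<chi> y] (mod int p)"
  using assms by (simp add: characters_def)

lemma character_dvd_mult:
  assumes "\<chi> \<in> characters" "x \<in> carrier G" "y \<in> carrier G"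
  shows "int p dvd \<chi> (x \<otimes> y) \<longleftrightarrow> int p dvd \<chi> x + \<chi> y"
  using character_mult[OF assms] by (rule cong_dvd_iff)

lemma character_one:
  assumes "\<chi> \<in> characters"
  shows "int p dvd \<chi> \<one>"
proof -
  have "[\<chi> \<one> = \<chi> \<one> + \<chi> \<one>] (mod int p)" using character_mult[OF assms, of \<one> \<one>] by simp
  then show ?thesis by (simp add: cong_iff_dvd_diff)
qed

lemma character_inv:
  assumes "\<chi> \<in> characters" "x \<in> carrier G"
  shows "int p dvd \<chi> (inv x) + \<chi> x"
  using character_dvd_mult[OF assms(1), of "inv x" x] character_one[OF assms(1)] assms(2) by simp

lemma subgroup_character_kernel:
  assumes \<chi>: "\<chi> \<in> characters"
  shows "subgroup {x \<in> carrier G. int p dvd \<chi> x} G" (is "subgroup ?K G")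
proof (rule subgroupI)
  show "?K \<noteq> {}" using character_one[OF \<chi>] by blast
next
  fix a assume "a \<in> ?K"
  then show "inv a \<in> ?K" using character_inv[OF \<chi>, of a] by (simp add: dvd_add_left_iff)
next
  fix a b assume "a \<in> ?K" "b \<in> ?K"
  then show "a \<otimes> b \<in> ?K" using character_dvd_mult[OF \<chi>] by simp
qed auto

lemma openin_character_kernel: "\<chi> \<in> characters \<Longrightarrow> openin T {x \<in> carrier G. int p dvd \<chi> x}"
  by (simp add: characters_def)

lemma zero_character: "(\<lambda>x. 0) \<in> characters"
  by (simp add: characters_def)

lemma character_lincomb:
  assumes \<chi>: "\<chi> \<in> characters" and \<psi>: "\<psi> \<in> characters"
  shows "(\<lambda>x. a * \<chi> x + b * \<psi> x) \<in> characters"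
proof -
  let ?f = "\<lambda>x. a * \<chi> x + b * \<psi> x"
  have mult: "[?f (x \<otimes> y) = ?f x + ?f y] (mod int p)" if "x \<in> carrier G" "y \<in> carrier G" for x y
  proof -
    have "[?f (x \<otimes> y) = a * (\<chi> x + \<chi> y) + b * (\<psi> x + \<psi> y)] (mod int p)"
      by (intro cong_add cong_mult cong_refl character_mult[OF \<chi> that] character_mult[OF \<psi> that])
    then show ?thesis by (simp add: algebra_simps)
  qed
  \<comment> \<open>The kernel of the combination is a union of cosets of this open subgroup, on
    which both characters vanish.\<close>
  let ?N = "{x \<in> carrier G. int p dvd \<chi> x} \<inter> {x \<in> carrier G. int p dvd \<psi> x}"
  have "openin T {x \<in> carrier G. int p dvd ?f x}"
  proof (rule openin_if_coset_closed)
    show "subgroup ?N G"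
      using subgroup_character_kernel[OF \<chi>] subgroup_character_kernel[OF \<psi>] by (rule subgroups_Inter_pair)
    show "openin T ?N" using openin_character_kernel[OF \<chi>] openin_character_kernel[OF \<psi>] by (rule openin_Int)
    fix n x assume nx: "n \<in> ?N" "x \<in> {x \<in> carrier G. int p dvd ?f x}"
    then have "int p dvd ?f n + ?f x" by simp
    then have "int p dvd ?f (n \<otimes> x)" using nx mult[of n x] cong_dvd_iff by blast
    then show "n \<otimes> x \<in> {x \<in> carrier G. int p dvd ?f x}" using nx by simp
  qed auto
  then show ?thesis using mult by (simp add: characters_def)
qed

lemma character_sum:
  assumes "finite A" "\<And>a. a \<in> A \<Longrightarrow> f a \<in> characters"
  shows "(\<lambda>x. \<Sum>a\<in>A. c a * f a x) \<in> characters"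
  using assms
proof (induction A rule: finite_induct)
  case empty
  then show ?case by (simp add: zero_character)
next
  case (insert a A)
  then have "(\<lambda>x. c a * f a x + 1 * (\<Sum>a\<in>A. c a * f a x)) \<in> characters"
    by (intro character_lincomb) auto
  then show ?case using insert by simp
qed

lemma character_comp:
  assumes \<chi>: "\<chi> \<in> characters" and f: "f \<in> cont_end G T"
  shows "(\<lambda>x. \<chi> (f x)) \<in> characters"
proof -
  have hom: "f \<in> hom G G" and cont: "continuous_map T T f" using f by (auto simp: cont_hom_def)
  have fc: "f x \<in> carrier G" if "x \<in> carrier G" for x using hom that by (rule hom_in_carrier)
  have "{x \<in> carrier G. int p dvd \<chi> (f x)} = {x \<in> carrier G. f x \<in> {y \<in> carrier G. int p dvd \<chi> y}}"
    using fc by blast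
  then have "openin T {x \<in> carrier G. int p dvd \<chi> (f x)}"
    using openin_preimage[OF cont openin_character_kernel[OF \<chi>]] by simp
  then show ?thesis using character_mult[OF \<chi>] hom fc by (simp add: characters_def hom_mult)
qed

lemma character_of_quotient:
  assumes N: "N \<lhd> G" "openin T N"
    and \<chi>: "\<forall>C\<in>carrier (G Mod N). \<forall>D\<in>carrier (G Mod N). [\<chi> (C \<otimes>\<^bsub>G Mod N\<^esub> D) = \<chi> C + \<chi> D] (mod int p)"
  shows "(\<lambda>x. \<chi> (N #> x)) \<in> characters"
proof -
  interpret N: normal N G by (rule N(1))
  have "[\<chi> (N #> (x \<otimes> y)) = \<chi> (N #> x) + \<chi> (N #> y)] (mod int p)"
    if "x \<in> carrier G" "y \<in> carrier G" for x y
    using \<chi> that by (auto simp: carrier_FactGroup N.rcos_sum)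
  moreover have "openin T {x \<in> carrier G. \<chi> (N #> x) \<in> {z. int p dvd z}}"
  proof (rule openin_coset_function[OF N.subgroup_axioms N(2)])
    fix n x assume "n \<in> N" "x \<in> carrier G"
    then have "N #> (n \<otimes> x) = N #> x"
      by (metis N.mem_carrier N.rcos_const N.subset coset_mult_assoc is_group)
    then show "\<chi> (N #> (n \<otimes> x)) = \<chi> (N #> x)" by simp
  qed
  ultimately show ?thesis by (simp add: characters_def)
qed

text \<open>A closed proper \<open>K\<close> misses a coset of some open normal \<open>N\<close>, so
  its image in the finite p-group \<open>G Mod N\<close> is still proper. A character of that
  quotient is pulled back.\<close>

lemma character_separating_closed_subgroup:
  assumes K: "subgroup K G" "closedin T K" "K \<noteq> carrier G"
  shows "\<exists>\<chi>\<in>characters. (\<forall>x\<in>K. int p dvd \<chi> x) \<and> (\<exists>x\<in>carrier G. \<not> int p dvd \<chi> x)"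
proof -
  obtain a where a: "a \<in> carrier G" "a \<notin> K" using K subgroup.subset by blast
  obtain N where N: "N \<lhd> G" "openin T N" "\<forall>n\<in>N. n \<otimes> a \<notin> K"
    using separate_from_closed[OF K(2) a] by blast
  interpret N: normal N G by (rule N(1))
  interpret Q: group "G Mod N" by (rule N.factorgroup_is_group)
  interpret q: group_hom G "G Mod N" "\<lambda>x. N #> x" by unfold_locales (rule N.r_coset_hom_Mod)
  let ?H = "(\<lambda>x. N #> x) ` K"
  have H: "subgroup ?H (G Mod N)" using K(1) by (rule q.subgroup_img_is_subgroup)
  have "N #> a \<notin> ?H"
  proof
    assume "N #> a \<in> ?H"
    then obtain k where k: "k \<in> K" "N #> a = N #> k" by blast
    then have "k \<in> carrier G" using K(1) subgroup.subset by blast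
    then have "k \<otimes> inv a \<in> N" using rcos_eq_iff[OF N.subgroup_axioms, of k a] a k by simp
    then have "(k \<otimes> inv a) \<otimes> a \<notin> K" using N(3) by blast
    then show False using k(1) a(1) \<open>k \<in> carrier G\<close> by (simp add: m_assoc)
  qed
  then have ne: "?H \<noteq> carrier (G Mod N)" using a by (auto simp: carrier_FactGroup)
  obtain k where k: "order (G Mod N) = p ^ k" using order_quotient[OF N(1,2)] by blast
  obtain \<chi> :: "'a set \<Rightarrow> int" where
    \<chi>: "\<forall>C\<in>carrier (G Mod N). \<forall>D\<in>carrier (G Mod N). [\<chi> (C \<otimes>\<^bsub>G Mod N\<^esub> D) = \<chi> C + \<chi> D] (mod int p)"
      "\<forall>C\<in>?H. int p dvd \<chi> C" "\<exists>C\<in>carrier (G Mod N). \<not> int p dvd \<chi> C"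
    using Q.p_group_character[OF prime_p k H ne] by blast
  have "(\<lambda>x. \<chi> (N #> x)) \<in> characters" by (rule character_of_quotient[OF N(1,2) \<chi>(1)])
  moreover have "\<forall>x\<in>K. int p dvd \<chi> (N #> x)" using \<chi>(2) by blast
  moreover have "\<exists>x\<in>carrier G. \<not> int p dvd \<chi> (N #> x)" using \<chi>(3) by (auto simp: carrier_FactGroup)
  ultimately show ?thesis by (intro bexI[of _ "\<lambda>x. \<chi> (N #> x)"]) auto
qed

text \<open>The common kernel of the homomorphisms to the group of order \<open>p\<close> is the
  Frattini subgroup of a pro-p group. In this form full invariance is immediate, since characters
  compose with endomorphisms.\<close>

definition frattini :: "'a set" where
  "frattini = {x \<in> carrier G. \<forall>\<chi>\<in>characters. int p dvd \<chi> x}"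

lemma subgroup_frattini: "subgroup frattini G"
proof -
  have "frattini = (\<Inter>\<chi>\<in>characters. {x \<in> carrier G. int p dvd \<chi> x})"
    using zero_character by (auto simp: frattini_def)
  also have "subgroup \<dots> G"
  proof (rule subgroups_Inter)
    show "(\<lambda>\<chi>. {x \<in> carrier G. int p dvd \<chi> x}) ` characters \<noteq> {}" using zero_character by blast
  qed (auto intro: subgroup_character_kernel)
  finally show ?thesis .
qed

lemma frattini_fully_invariant:
  assumes f: "f \<in> cont_end G T" and x: "x \<in> frattini"
  shows "f x \<in> frattini"
  using x character_comp[OF _ f] f by (auto simp: frattini_def cont_hom_def hom_def)

section \<open>Continuous endomorphisms and automorphisms\<close>

lemma cont_end_closed: "f \<in> cont_end G T \<Longrightarrow> x \<in> carrier G \<Longrightarrow> f x \<in> carrier G"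
  by (auto simp: cont_hom_def hom_def)

lemma cont_end_comp:
  assumes f: "f \<in> cont_end G T" and g: "g \<in> cont_end G T"
  shows "f \<circ> g \<in> cont_end G T"
  using assms Group.hom_compose[of g G G f] continuous_map_compose[of T T g T f]
  unfolding cont_hom_def by blast

lemma cont_end_id: "id \<in> cont_end G T"
  by (auto simp: cont_hom_def hom_def)

lemma cont_aut_imp_end: "f \<in> cont_aut G T \<Longrightarrow> f \<in> cont_end G T"
  by (auto simp: cont_hom_def cont_iso_def iso_def homeomorphic_imp_continuous_map)

lemma cont_aut_comp: "f \<in> cont_aut G T \<Longrightarrow> g \<in> cont_aut G T \<Longrightarrow> f \<circ> g \<in> cont_aut G T"
  using iso_set_trans[of g G G f] homeomorphic_map_compose[of T T g T f]
  unfolding cont_iso_def by blast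

lemma cont_aut_inverse:
  assumes f: "f \<in> cont_aut G T"
  shows "\<exists>g\<in>cont_aut G T. (\<forall>x\<in>carrier G. g (f x) = x) \<and> (\<forall>x\<in>carrier G. f (g x) = x)"
proof -
  have iso: "f \<in> iso G G" and bij: "bij_betw f (carrier G) (carrier G)" and hf: "homeomorphic_map T T f"
    using f by (auto simp: cont_iso_def iso_def)
  let ?g = "inv_into (carrier G) f"
  have "?g \<in> iso G G" using iso by (rule iso_set_sym)
  moreover have gf: "\<forall>x\<in>carrier G. ?g (f x) = x" "\<forall>x\<in>carrier G. f (?g x) = x"
    using bij by (auto simp: bij_betw_inv_into_left bij_betw_inv_into_right)
  moreover have "homeomorphic_map T T ?g"
  proof -
    \<comment> \<open>The topological inverse \<open>g\<close> and the algebraic inverse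
      \<open>?g\<close> agree on the carrier, so continuity passes from one to the other.\<close>
    obtain g where g: "homeomorphic_maps T T f g" using hf homeomorphic_map_maps by blast
    then have "continuous_map T T g" "\<And>x. x \<in> carrier G \<Longrightarrow> g x = ?g x"
      using bij unfolding homeomorphic_maps_def by (auto simp: bij_betw_def inv_into_f_eq f_inv_into_f continuous_map_def Pi_def intro!: inv_into_f_eq[symmetric])
    then have "continuous_map T T ?g" using continuous_map_eq[of T T g ?g] by simp
    then have "homeomorphic_maps T T ?g f"
      using gf homeomorphic_imp_continuous_map[OF hf] by (simp add: homeomorphic_maps_def)
    then show ?thesis using homeomorphic_map_maps by blast
  qed
  ultimately show ?thesis by (intro bexI[of _ ?g]) (auto simp: cont_iso_def)
qed

lemma closed_image_subgroup:
  assumes f: "f \<in> cont_end G T"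
  shows "subgroup (f ` carrier G) G" "closedin T (f ` carrier G)"
proof -
  have hom: "f \<in> hom G G" and cont: "continuous_map T T f" using f by (auto simp: cont_hom_def)
  show "subgroup (f ` carrier G) G"
    using hom by (intro group_hom.img_is_subgroup) (simp add: group_hom_def group_hom_axioms_def)
  have "compactin T (f ` carrier G)"
    using image_compactin[OF _ cont, of "carrier G"] compact by (simp add: compact_space_def)
  then show "closedin T (f ` carrier G)" using Hausdorff by (simp add: compactin_imp_closedin)
qed

end

subsection \<open>Pro-p groups with a basis\<close>

locale pro_p_gen = pro_p +
  fixes X
  assumes finite_X: "finite X" and X_carrier: "X \<subseteq> carrier G"
    and generates: "\<And>K. subgroup K G \<Longrightarrow> closedin T K \<Longrightarrow> X \<subseteq> K \<Longrightarrow> K = carrier G"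

context pro_p_gen
begin

text \<open>The equalizer contains the intersection of two open kernels, so it is an open and hence
  closed subgroup containing \<open>X\<close>. Open kernels stand in for a topology on
  \<open>Q\<close>.\<close>

lemma hom_eq_on_generators:
  assumes Q: "group Q" and f: "f \<in> hom G Q" and g: "g \<in> hom G Q"
    and open_f: "openin T {x \<in> carrier G. f x = \<one>\<^bsub>Q\<^esub>}" and open_g: "openin T {x \<in> carrier G. g x = \<one>\<^bsub>Q\<^esub>}"
    and eq: "\<And>x. x \<in> X \<Longrightarrow> f x = g x" and y: "y \<in> carrier G"
  shows "f y = g y"
proof -
  interpret Q: group Q by (rule Q)
  interpret f: group_hom G Q f using f by unfold_locales
  interpret g: group_hom G Q g using g by unfold_locales
  let ?E = "{x \<in> carrier G. f x = g x}"
  let ?N = "{x \<in> carrier G. f x = \<one>\<^bsub>Q\<^esub>} \<inter> {x \<in> carrier G. g x = \<one>\<^bsub>Q\<^esub>}"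
  have E: "subgroup ?E G"
    by (rule subgroupI) (auto intro!: exI[of _ \<one>])
  have N: "subgroup ?N G"
    by (rule subgroupI) (auto intro!: exI[of _ \<one>])
  have "openin T ?N" using open_f open_g by (rule openin_Int)
  then have "openin T ?E" by (rule openin_subgroup_mono[OF N _ E]) auto
  then have "closedin T ?E" by (rule closedin_open_subgroup[OF E])
  then have "?E = carrier G" using X_carrier eq by (intro generates[OF E]) auto
  then show ?thesis using y by blast
qed

lemma character_zero_on_generators:
  assumes \<chi>: "\<chi> \<in> characters" and X: "\<And>x. x \<in> X \<Longrightarrow> int p dvd \<chi> x" and y: "y \<in> carrier G"
  shows "int p dvd \<chi> y"
proof -
  have "{x \<in> carrier G. int p dvd \<chi> x} = carrier G"
    using X X_carrier subgroup_character_kernel[OF \<chi>] openin_character_kernel[OF \<chi>]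
    by (intro generates closedin_open_subgroup) auto
  then show ?thesis using y by blast
qed

text \<open>A character is determined modulo \<open>p\<close> by its residues on the finite set
  \<open>X\<close>, so there are only finitely many kernels to intersect.\<close>

lemma openin_frattini: "openin T frattini"
proof -
  let ?r = "\<lambda>\<chi>. restrict (\<lambda>x. \<chi> x mod int p) X"
  let ?A = "\<lambda>\<chi>. {x \<in> carrier G. int p dvd \<chi> x}"
  have "p > 0" using prime_p prime_gt_0_nat by blast
  then have "?r ` characters \<subseteq> X \<rightarrow>\<^sub>E {0..<int p}" by auto
  then have "finite (?r ` characters)" using finite_X finite_subset finite_PiE by (metis finite_atLeastLessThan_int)
  moreover have mono: "?A \<chi> \<subseteq> ?A \<psi>" if c: "\<chi> \<in> characters" "\<psi> \<in> characters" "?r \<chi> = ?r \<psi>" for \<chi> \<psi>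
  proof
    fix x assume x: "x \<in> ?A \<chi>"
    have d: "(\<lambda>x. 1 * \<psi> x + (- 1) * \<chi> x) \<in> characters" using c by (intro character_lincomb)
    have "int p dvd 1 * \<psi> y + (- 1) * \<chi> y" if "y \<in> X" for y
    proof -
      have "\<chi> y mod int p = \<psi> y mod int p" using fun_cong[OF c(3), of y] that by simp
      then have "int p dvd \<psi> y - \<chi> y" by (metis mod_eq_dvd_iff)
      then show ?thesis by simp
    qed
    then have "int p dvd 1 * \<psi> x + (- 1) * \<chi> x" using character_zero_on_generators[OF d, of x] x by blast
    then show "x \<in> ?A \<psi>" using x by (simp add: dvd_diff_left_iff)
  qed
  ultimately have "finite (?A ` characters)"
    by (elim finite_image_factor) (rule subset_antisym; rule mono; simp)
  then have "openin T (\<Inter>(?A ` characters))"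
    using zero_character openin_character_kernel by (intro openin_Inter) blast+
  moreover have "frattini = \<Inter>(?A ` characters)" using zero_character by (auto simp: frattini_def)
  ultimately show ?thesis by simp
qed

text \<open>For \<open>N \<subseteq> carrier G\<close>, the largest subset of \<open>N\<close>
  stable under all continuous endomorphisms. It provides arbitrarily small open normal subgroups on
  whose quotients every endomorphism acts.\<close>

definition invariant_core :: "'a set \<Rightarrow> 'a set" where
  "invariant_core N = {x \<in> carrier G. \<forall>f\<in>cont_end G T. f x \<in> N}"

lemma invariant_core_subset: "invariant_core N \<subseteq> N"
  using cont_end_id by (force simp: invariant_core_def)

lemma invariant_core_invariant:
  assumes f: "f \<in> cont_end G T" and x: "x \<in> invariant_core N"
  shows "f x \<in> invariant_core N"
  using x cont_end_closed[OF f] cont_end_comp[OF _ f] by (force simp: invariant_core_def)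

lemma group_hom_cont_end: "f \<in> cont_end G T \<Longrightarrow> group_hom G G f"
  by unfold_locales (simp add: cont_hom_def)

lemma normal_invariant_core:
  assumes N: "N \<lhd> G"
  shows "invariant_core N \<lhd> G"
proof -
  interpret N: normal N G by (rule N)
  have one: "f \<one> = \<one>" if "f \<in> cont_end G T" for f
    using group_hom_cont_end[OF that] by (rule group_hom.hom_one)
  have e: "f (x \<otimes> y) = f x \<otimes> f y" "f (inv x) = inv (f x)" "f x \<in> carrier G"
    if "f \<in> cont_end G T" "x \<in> carrier G" "y \<in> carrier G" for f x y
    using group_hom_cont_end[OF that(1)] that(2,3) by (simp_all add: group_hom.hom_closed group_hom.hom_mult[of G G] group_hom.hom_inv)
  have "subgroup (invariant_core N) G"
    by (rule subgroupI) (auto simp: invariant_core_def e one intro!: exI[of _ \<one>])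
  moreover have "x \<otimes> h \<otimes> inv x \<in> invariant_core N" if "x \<in> carrier G" "h \<in> invariant_core N" for x h
    using that by (auto simp: invariant_core_def e N.inv_op_closed2)
  ultimately show ?thesis by (simp add: normal_inv_iff)
qed

text \<open>The preimage of \<open>N\<close> under \<open>f\<close> depends only on the cosets
  \<open>N #> f x\<close> for \<open>x \<in> X\<close>. These take finitely many values, so the core
  is a finite intersection of open preimages.\<close>

lemma openin_invariant_core:
  assumes N: "N \<lhd> G" "openin T N"
  shows "openin T (invariant_core N)"
proof -
  interpret N: normal N G by (rule N)
  interpret Q: group "G Mod N" by (rule N.factorgroup_is_group)
  let ?r = "\<lambda>f. restrict (\<lambda>x. N #> f x) X"
  let ?A = "\<lambda>f. {x \<in> carrier G. f x \<in> N}"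
  have fin: "finite (rcosets N)" by (rule finite_rcosets[OF compact N.subgroup_axioms N(2)])
  have "N #> f x \<in> rcosets N" if "f \<in> cont_end G T" "x \<in> X" for f x
    using rcosetsI[OF N.subset] cont_end_closed[OF that(1)] that(2) X_carrier by blast
  then have "?r ` cont_end G T \<subseteq> X \<rightarrow>\<^sub>E rcosets N" by auto
  then have fin_r: "finite (?r ` cont_end G T)"
    by (rule finite_subset) (use finite_X fin in \<open>simp add: finite_PiE\<close>)
  have op: "openin T (?A f)" if "f \<in> cont_end G T" for f
    using that by (intro openin_preimage[OF _ N(2)]) (auto simp: cont_hom_def)
  have Nx: "N #> x = N \<longleftrightarrow> x \<in> N" if "x \<in> carrier G" for x
    using that by (metis N.rcos_const is_group rcos_self N.subgroup_axioms)
  have fNx: "{x \<in> carrier G. N #> f x = \<one>\<^bsub>G Mod N\<^esub>} = ?A f" if "f \<in> cont_end G T" for f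
    using Nx cont_end_closed[OF that] by auto
  have hom: "(\<lambda>x. N #> f x) \<in> hom G (G Mod N)" if "f \<in> cont_end G T" for f
    using Group.hom_compose[of f G G "\<lambda>x. N #> x"] N.r_coset_hom_Mod that by (simp add: cont_hom_def o_def)
  have eqA: "?A f = ?A g" if fg: "f \<in> cont_end G T" "g \<in> cont_end G T" "?r f = ?r g" for f g
  proof -
    have "N #> f x = N #> g x" if "x \<in> X" for x using fun_cong[OF fg(3), of x] that by simp
    then have "N #> f x = N #> g x" if "x \<in> carrier G" for x
      using hom_eq_on_generators[OF Q.is_group hom[OF fg(1)] hom[OF fg(2)]] fNx fg op that by simp
    then show ?thesis using Nx cont_end_closed fg by (metis (no_types, lifting))
  qed
  have "finite (?A ` cont_end G T)" using fin_r by (rule finite_image_factor) (rule eqA)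
  then have "openin T (\<Inter>(?A ` cont_end G T))"
    using cont_end_id op by (intro openin_Inter) blast+
  moreover have "invariant_core N = \<Inter>(?A ` cont_end G T)" using cont_end_id by (auto simp: invariant_core_def)
  ultimately show ?thesis by simp
qed

text \<open>The Hopf property. A nontrivial kernel element would survive in the finite quotient by
  some open invariant core, where the induced surjection is injective. Compactness and the Hausdorff
  property make the inverse continuous.\<close>

lemma surj_cont_end_imp_aut:
  assumes f: "f \<in> cont_end G T" and surj: "f ` carrier G = carrier G"
  shows "f \<in> cont_aut G T"
proof -
  have hom: "f \<in> hom G G" and cont: "continuous_map T T f" using f by (auto simp: cont_hom_def)
  interpret f: group_hom G G f using hom by unfold_locales
  have "x = \<one>" if x: "x \<in> carrier G" "f x = \<one>" for x
  proof (rule ccontr)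
    assume "x \<noteq> \<one>"
    then obtain N where N: "N \<lhd> G" "openin T N" "x \<notin> N" using separate_from_one x(1) by blast
    let ?M = "invariant_core N"
    have M: "subgroup ?M G" using normal_invariant_core[OF N(1)] by (rule normal_imp_subgroup)
    have fin: "finite (rcosets ?M)" by (rule finite_rcosets[OF compact M openin_invariant_core[OF N(1,2)]])
    have inv: "f ` ?M \<subseteq> ?M" using invariant_core_invariant[OF f] by blast
    have "\<forall>y\<in>carrier G. \<exists>x\<in>carrier G. ?M #> f x = ?M #> y"
    proof
      fix y assume "y \<in> carrier G"
      then have "y \<in> f ` carrier G" using surj by simp
      then obtain x where "x \<in> carrier G" "f x = y" by blast
      then show "\<exists>x\<in>carrier G. ?M #> f x = ?M #> y" by (intro bexI[of _ x]) simp_all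
    qed
    then have "\<forall>x\<in>carrier G. f x \<in> ?M \<longrightarrow> x \<in> ?M" using surj_mod_iff_inj_mod[OF M fin hom inv] by simp
    then have "x \<in> ?M" using x subgroup.one_closed[OF M] by simp
    then show False using N(3) invariant_core_subset by blast
  qed
  then have inj: "inj_on f (carrier G)" by (auto intro: f.inj_on_one_iff[THEN iffD2])
  then have "f \<in> iso G G" using hom surj by (simp add: iso_def bij_betw_def)
  moreover have "homeomorphic_map T T f"
    using continuous_imp_homeomorphic_map[OF cont compact Hausdorff] surj inj by simp
  ultimately show ?thesis by (simp add: cont_iso_def)
qed

lemma cont_end_surj_if_generators:
  assumes f: "f \<in> cont_end G T" and X: "X \<subseteq> f ` carrier G"
  shows "f ` carrier G = carrier G"
  using closed_image_subgroup[OF f] X by (intro generates)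

section \<open>Endomorphisms with image in the Frattini subgroup\<close>

lemma cont_end_into_frattini:
  assumes f: "f \<in> cont_end G T" and X: "f ` X \<subseteq> frattini" and x: "x \<in> carrier G"
  shows "f x \<in> frattini"
proof -
  have "int p dvd \<chi> (f x)" if "\<chi> \<in> characters" for \<chi>
    using character_zero_on_generators[OF character_comp[OF that f] _ x] X that
    by (auto simp: frattini_def)
  then show ?thesis using cont_end_closed[OF f x] by (simp add: frattini_def)
qed

lemma funpow_cont_end:
  assumes f: "f \<in> cont_end G T"
  shows "f ^^ n \<in> cont_end G T"
proof (induction n)
  case 0
  then show ?case using cont_end_id by (simp add: id_def)
next
  case (Suc n)
  then show ?case using cont_end_comp[OF f, of "f ^^ n"] by (simp only: funpow.simps)
qed

lemma cont_end_into_frattini_nilpotent: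
  assumes f: "f \<in> cont_end G T" and into: "\<And>x. x \<in> carrier G \<Longrightarrow> f x \<in> frattini"
    and N: "N \<lhd> G" "openin T N" and inv: "f ` N \<subseteq> N"
  shows "\<exists>n. \<forall>x\<in>carrier G. (f ^^ n) x \<in> N"
proof -
  interpret N: normal N G by (rule N)
  interpret Q: group "G Mod N" by (rule N.factorgroup_is_group)
  define A where "A n = (\<lambda>x. N #> (f ^^ n) x) ` carrier G" for n
  have hom: "(\<lambda>x. N #> (f ^^ n) x) \<in> hom G (G Mod N)" for n
    using Group.hom_compose[of "f ^^ n" G G "\<lambda>x. N #> x"] N.r_coset_hom_Mod funpow_cont_end[OF f, of n]
    by (simp add: cont_hom_def o_def)
  have fc: "(f ^^ n) x \<in> carrier G" if "x \<in> carrier G" for n x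
    using cont_end_closed[OF funpow_cont_end[OF f]] that .
  have fN: "(f ^^ n) x \<in> N" if "x \<in> N" for n x
    using that inv by (induction n) auto
  have "A 0 \<subseteq> rcosets N" by (auto simp: A_def RCOSETS_def)
  then have "finite (A 0)" using finite_rcosets[OF compact N.subgroup_axioms N(2)] finite_subset by blast
  moreover have "A (Suc n) \<subseteq> A n" for n
    unfolding A_def using cont_end_closed[OF f] by (auto simp: funpow_swap1)
  ultimately obtain n where n: "A (Suc n) = A n" using decreasing_finite_stabilizes[of A] by blast
  have sub: "subgroup (A n) (G Mod N)"
    unfolding A_def using hom by (intro group_hom.img_is_subgroup) (simp add: group_hom_def group_hom_axioms_def)
  have "A n = {N}"
  proof (rule ccontr)
    assume ne: "A n \<noteq> {N}"
    let ?R = "(G Mod N)\<lparr>carrier := A n\<rparr>"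
    interpret R: group ?R using sub Q.is_group by (rule subgroup.subgroup_is_group)
    obtain k where "order (G Mod N) = p ^ k" using order_quotient[OF N] by blast
    then obtain i where i: "order ?R = p ^ i"
      using Q.card_subgroup_prime_power[OF prime_p _ sub] by (auto simp: order_def)
    have triv: "subgroup {\<one>\<^bsub>?R\<^esub>} ?R" by (rule R.triv_subgroup)
    have ne': "{\<one>\<^bsub>?R\<^esub>} \<noteq> carrier ?R" using ne by simp
    obtain \<chi> :: "'a set \<Rightarrow> int" where
      \<chi>: "\<forall>C\<in>carrier ?R. \<forall>D\<in>carrier ?R. [\<chi> (C \<otimes>\<^bsub>?R\<^esub> D) = \<chi> C + \<chi> D] (mod int p)"
        "\<exists>C\<in>carrier ?R. \<not> int p dvd \<chi> C"
      using R.p_group_character[OF prime_p i triv ne'] by (elim exE conjE) (rule that)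
    let ?\<psi> = "\<lambda>x. \<chi> (N #> (f ^^ n) x)"
    have "[?\<psi> (x \<otimes> y) = ?\<psi> x + ?\<psi> y] (mod int p)" if "x \<in> carrier G" "y \<in> carrier G" for x y
      using \<chi>(1) hom_mult[OF hom that, of n] that by (simp add: A_def)
    moreover have "openin T {x \<in> carrier G. ?\<psi> x \<in> {z. int p dvd z}}"
    proof (rule openin_coset_function[OF N.subgroup_axioms N(2)])
      fix m x assume mx: "m \<in> N" "x \<in> carrier G"
      then have "(f ^^ n) (m \<otimes> x) = (f ^^ n) m \<otimes> (f ^^ n) x"
        using funpow_cont_end[OF f, of n] N.subset by (auto simp: cont_hom_def hom_def)
      also have "N #> \<dots> = N #> (f ^^ n) x"
        using fN[OF mx(1)] fc[OF mx(2)] by (metis N.mem_carrier N.rcos_const N.subset coset_mult_assoc is_group)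
      finally show "?\<psi> (m \<otimes> x) = ?\<psi> x" by simp
    qed
    ultimately have \<psi>: "?\<psi> \<in> characters" by (simp add: characters_def)
    obtain C where C: "C \<in> A n" "\<not> int p dvd \<chi> C" using \<chi>(2) by auto
    then obtain y where y: "y \<in> carrier G" "C = N #> (f ^^ Suc n) y" using n unfolding A_def by blast
    \<comment> \<open>\<open>C\<close> is the coset of \<open>(f ^^ n) (f y)\<close>, so \<chi>
      takes at \<open>C\<close> the value of \<open>?\<psi>\<close> at the Frattini element
      \<open>f y\<close>.\<close>
    have "\<forall>\<eta>\<in>characters. int p dvd \<eta> (f y)" using into[OF y(1)] by (simp add: frattini_def)
    from bspec[OF this \<psi>] show False using C(2) y(2) by (simp add: funpow_swap1)
  qed
  then have "(f ^^ n) x \<in> N" if "x \<in> carrier G" for x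
    using that fc[OF that, of n] unfolding A_def
    by (metis (no_types, lifting) image_eqI N.subgroup_axioms rcos_self singletonD)
  then show ?thesis by blast
qed

end

text \<open>Only maps into \<open>G\<close> itself are extended. This is what the orbit argument
  uses and, unlike freeness among all pro-p groups, it survives quotients by closed fully invariant
  subgroups.\<close>

locale pro_p_basis = pro_p_gen +
  assumes extends: "\<And>f. f \<in> X \<rightarrow> carrier G \<Longrightarrow> \<exists>h\<in>cont_end G T. \<forall>x\<in>X. h x = f x"

context pro_p_basis
begin

text \<open>If no replacement of a generator \<open>x\<close> by \<open>v\<close> gave an automorphism, there would be
  characters \<open>\<chi> x\<close> vanishing at \<open>v\<close> that are dual to the basis up to units. They span all
  characters, so \<open>v\<close> would lie in the Frattini subgroup.\<close>

lemma exchange_generator: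
  assumes v: "v \<in> carrier G" "v \<notin> frattini"
  shows "\<exists>x\<in>X. \<exists>\<alpha>\<in>cont_aut G T. \<alpha> x = v"
proof (rule ccontr)
  assume contra: "\<not> ?thesis"
  have "\<exists>\<chi>\<in>characters. (\<forall>y\<in>X - {x}. int p dvd \<chi> y) \<and> int p dvd \<chi> v \<and> \<not> int p dvd \<chi> x"
    if x: "x \<in> X" for x
  proof -
    \<comment> \<open>The extension of this map is not surjective by assumption, so a nonzero
      character kills its image, that is, \<open>v\<close> and all of \<open>X - {x}\<close>. It
      cannot kill \<open>x\<close> too, since \<open>X\<close> generates.\<close>
    have "(\<lambda>y. if y = x then v else y) \<in> X \<rightarrow> carrier G" using v X_carrier by auto
    then obtain h where h: "h \<in> cont_end G T" "\<And>y. y \<in> X \<Longrightarrow> h y = (if y = x then v else y)"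
      using extends by blast
    have "h x = v" using h(2)[OF x] by simp
    then have "h ` carrier G \<noteq> carrier G" using contra x surj_cont_end_imp_aut[OF h(1)] by blast
    then obtain \<chi> where \<chi>: "\<chi> \<in> characters" "\<forall>z\<in>h ` carrier G. int p dvd \<chi> z" "\<exists>z\<in>carrier G. \<not> int p dvd \<chi> z"
      using character_separating_closed_subgroup[OF closed_image_subgroup[OF h(1)]] by blast
    have hX: "int p dvd \<chi> (h y)" if "y \<in> X" for y
      using \<chi>(2) that X_carrier by blast
    have other: "int p dvd \<chi> y" if "y \<in> X - {x}" for y
      using hX[of y] h(2)[of y] that by simp
    have "int p dvd \<chi> v" using hX[OF x] \<open>h x = v\<close> by simp
    moreover have "\<not> int p dvd \<chi> x"
    proof
      assume "int p dvd \<chi> x"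
      then have "int p dvd \<chi> y" if "y \<in> X" for y using other that by (cases "y = x") auto
      from character_zero_on_generators[OF \<chi>(1) this] show False using \<chi>(3) by blast
    qed
    ultimately show ?thesis using \<chi>(1) other by (intro bexI[of _ \<chi>]) auto
  qed
  then obtain \<chi> where \<chi>: "\<And>x. x \<in> X \<Longrightarrow> \<chi> x \<in> characters"
      "\<And>x y. x \<in> X \<Longrightarrow> y \<in> X - {x} \<Longrightarrow> int p dvd \<chi> x y"
      "\<And>x. x \<in> X \<Longrightarrow> int p dvd \<chi> x v" "\<And>x. x \<in> X \<Longrightarrow> \<not> int p dvd \<chi> x x"
    by metis
  obtain \<xi> where \<xi>: "\<xi> \<in> characters" "\<not> int p dvd \<xi> v" using v by (auto simp: frattini_def)
  \<comment> \<open>Inverting the unit \<open>\<chi> x x\<close> modulo \<open>p\<close> gives the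
    coefficient with which \<open>\<chi> x\<close> matches \<xi> at \<open>x\<close>.\<close>
  have "\<exists>c. int p dvd \<xi> x - c * \<chi> x x" if x: "x \<in> X" for x
  proof -
    have "coprime (\<chi> x x) (int p)"
      using \<chi>(4)[OF x] prime_p by (metis coprime_commute prime_imp_coprime prime_nat_int_transfer)
    then obtain d where "[\<chi> x x * d = 1] (mod int p)" using cong_solve_coprime_int by blast
    then have "[\<xi> x * (\<chi> x x * d) = \<xi> x * 1] (mod int p)" by (intro cong_mult cong_refl)
    then have "[\<xi> x = (\<xi> x * d) * \<chi> x x] (mod int p)" by (simp add: cong_sym_eq ac_simps)
    then show ?thesis by (auto simp: cong_iff_dvd_diff)
  qed
  then obtain c where c: "\<And>x. x \<in> X \<Longrightarrow> int p dvd \<xi> x - c x * \<chi> x x" by metis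
  let ?s = "\<lambda>z. \<Sum>x\<in>X. c x * \<chi> x z"
  have s: "?s \<in> characters" using finite_X \<chi>(1) by (rule character_sum)
  have d: "(\<lambda>z. 1 * \<xi> z + (- 1) * ?s z) \<in> characters" using \<xi>(1) s by (rule character_lincomb)
  \<comment> \<open>At a basis element \<open>y\<close> only the summand indexed by \<open>y\<close>
    survives modulo \<open>p\<close>. Agreement on \<open>X\<close> then spreads to
    \<open>v\<close>, where the sum vanishes but \<xi> does not.\<close>
  have "int p dvd 1 * \<xi> y + (- 1) * ?s y" if y: "y \<in> X" for y
  proof -
    have "?s y = c y * \<chi> y y + (\<Sum>x\<in>X - {y}. c x * \<chi> x y)" using finite_X y by (rule sum.remove)
    moreover have "int p dvd (\<Sum>x\<in>X - {y}. c x * \<chi> x y)" using \<chi>(2) y by (intro dvd_sum dvd_mult) auto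
    ultimately show ?thesis using c[OF y] dvd_diff by (fastforce simp: algebra_simps)
  qed
  then have "int p dvd 1 * \<xi> v + (- 1) * ?s v" using character_zero_on_generators[OF d] v(1) by blast
  moreover have "int p dvd ?s v" using \<chi>(3) by (intro dvd_sum dvd_mult)
  ultimately have "int p dvd \<xi> v" by (simp add: dvd_diff_left_iff)
  then show False using \<xi>(2) by simp
qed

text \<open>The transposition of \<open>x\<close> and \<open>y\<close> permutes \<open>X\<close>, so
  the image of its extension contains all generators.\<close>

lemma aut_transitive_on_generators:
  assumes xy: "x \<in> X" "y \<in> X"
  shows "\<exists>\<alpha>\<in>cont_aut G T. \<alpha> x = y"
proof -
  define t where "t z = (if z = x then y else if z = y then x else z)" for z
  have "t \<in> X \<rightarrow> carrier G" using xy X_carrier by (auto simp: t_def)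
  then obtain h where h: "h \<in> cont_end G T" "\<And>z. z \<in> X \<Longrightarrow> h z = t z" using extends by blast
  have "X \<subseteq> h ` carrier G"
  proof
    fix z assume z: "z \<in> X"
    then have "t z \<in> X" "t (t z) = z" using xy by (auto simp: t_def)
    then have "h (t z) = z" "t z \<in> carrier G" using h(2)[of "t z"] X_carrier by auto
    then show "z \<in> h ` carrier G" by (metis image_eqI)
  qed
  then have "h \<in> cont_aut G T" using cont_end_surj_if_generators[OF h(1)] surj_cont_end_imp_aut[OF h(1)] by blast
  moreover have "h x = y" using h(2)[OF xy(1)] by (simp add: t_def)
  ultimately show ?thesis by blast
qed

lemma aut_transitive_off_frattini:
  assumes v: "v \<in> carrier G" "v \<notin> frattini" and w: "w \<in> carrier G" "w \<notin> frattini"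
  shows "\<exists>\<alpha>\<in>cont_aut G T. \<alpha> v = w"
proof -
  obtain x \<alpha> where \<alpha>: "x \<in> X" "\<alpha> \<in> cont_aut G T" "\<alpha> x = v" using exchange_generator[OF v] by blast
  obtain y \<beta> where \<beta>: "y \<in> X" "\<beta> \<in> cont_aut G T" "\<beta> y = w" using exchange_generator[OF w] by blast
  obtain \<gamma> where \<gamma>: "\<gamma> \<in> cont_aut G T" "\<gamma> x = y" using aut_transitive_on_generators \<alpha>(1) \<beta>(1) by blast
  obtain \<alpha>' where \<alpha>': "\<alpha>' \<in> cont_aut G T" "\<forall>x\<in>carrier G. \<alpha>' (\<alpha> x) = x" using cont_aut_inverse[OF \<alpha>(2)] by blast
  have "\<alpha>' v = x" using \<alpha>'(2) \<alpha>(1,3) X_carrier by blast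
  then have "(\<beta> \<circ> (\<gamma> \<circ> \<alpha>')) v = w" using \<gamma>(2) \<beta>(3) by simp
  moreover have "\<beta> \<circ> (\<gamma> \<circ> \<alpha>') \<in> cont_aut G T" using \<alpha>'(1) \<beta>(2) \<gamma>(1) by (intro cont_aut_comp)
  ultimately show ?thesis by blast
qed

theorem orbit_preserving_cont_end_is_aut:
  assumes u: "u \<in> carrier G" "u \<noteq> \<one>" and \<phi>: "\<phi> \<in> cont_end G T"
    and orb: "\<phi> ` aut_orbit G T u \<subseteq> aut_orbit G T u"
  shows "\<phi> \<in> cont_aut G T"
proof (rule ccontr)
  assume not_aut: "\<phi> \<notin> cont_aut G T"
  let ?M = "{\<theta> \<in> cont_end G T. \<theta> ` aut_orbit G T u \<subseteq> aut_orbit G T u}"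
  have M_comp: "f \<circ> g \<in> ?M" if "f \<in> ?M" "g \<in> ?M" for f g
    using that cont_end_comp by (auto simp: image_subset_iff)
  have M_aut: "\<alpha> \<in> ?M" if \<alpha>: "\<alpha> \<in> cont_aut G T" for \<alpha>
  proof -
    have "\<alpha> v \<in> aut_orbit G T u" if "v \<in> aut_orbit G T u" for v
    proof -
      obtain \<beta> where "\<beta> \<in> cont_aut G T" "v = \<beta> u" using \<open>v \<in> aut_orbit G T u\<close> by (auto simp: aut_orbit_def)
      then have "\<alpha> \<circ> \<beta> \<in> cont_aut G T" "\<alpha> v = (\<alpha> \<circ> \<beta>) u" using cont_aut_comp \<alpha> by auto
      then show ?thesis unfolding aut_orbit_def by blast
    qed
    then show ?thesis using cont_aut_imp_end[OF \<alpha>] by blast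
  qed
  have F: "subgroup frattini G" by (rule subgroup_frattini)
  have "\<phi> ` carrier G \<noteq> carrier G" using not_aut surj_cont_end_imp_aut[OF \<phi>] by blast
  then obtain \<chi> where \<chi>: "\<chi> \<in> characters" "\<forall>z\<in>\<phi> ` carrier G. int p dvd \<chi> z" "\<exists>z\<in>carrier G. \<not> int p dvd \<chi> z"
    using character_separating_closed_subgroup[OF closed_image_subgroup[OF \<phi>]] by blast
  then obtain z where z: "z \<in> carrier G" "\<not> int p dvd \<chi> z" by blast
  \<comment> \<open>\<chi> vanishes on the image of \<phi> and on the Frattini subgroup but not at
    \<open>z\<close>, so \<phi> misses the coset of \<open>z\<close>. Counting cosets turns this
    failure of surjectivity into the kernel element \<open>w\<close>.\<close>
  have "frattini #> \<phi> x \<noteq> frattini #> z" if x: "x \<in> carrier G" for x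
  proof
    assume "frattini #> \<phi> x = frattini #> z"
    then have "\<phi> x \<otimes> inv z \<in> frattini" using rcos_eq_iff[OF F] cont_end_closed[OF \<phi> x] z(1) by simp
    then have "int p dvd \<chi> (\<phi> x) + \<chi> (inv z)"
      using \<chi>(1) character_dvd_mult[OF \<chi>(1) cont_end_closed[OF \<phi> x], of "inv z"] z(1) by (auto simp: frattini_def)
    moreover have "int p dvd \<chi> (\<phi> x)" using \<chi>(2) x by blast
    ultimately have "int p dvd \<chi> (inv z)" by (simp add: dvd_add_right_iff)
    then show False using character_inv[OF \<chi>(1) z(1)] z(2) by (simp add: dvd_add_right_iff)
  qed
  moreover have "finite (rcosets frattini)" by (rule finite_rcosets[OF compact F openin_frattini])
  moreover have "\<phi> ` frattini \<subseteq> frattini" using frattini_fully_invariant[OF \<phi>] by blast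
  moreover have "\<phi> \<in> hom G G" using \<phi> by (simp add: cont_hom_def)
  ultimately obtain w where w: "w \<in> carrier G" "\<phi> w \<in> frattini" "w \<notin> frattini"
    using surj_mod_iff_inj_mod[OF F, of \<phi>] z(1) by blast
  \<comment> \<open>The induction keeps \<open>w\<close> among the killed elements: \<open>w\<close>
    is where the next automorphism sends a value that is not yet killed.\<close>
  have kill: "\<exists>\<theta>\<in>?M. \<theta> ` S \<subseteq> frattini \<and> \<theta> w \<in> frattini" if "finite S" "S \<subseteq> carrier G" for S
    using that
  proof (induction S rule: finite_induct)
    case empty
    then show ?case using w(2) \<phi> orb by blast
  next
    case (insert y S)
    then obtain \<theta> where \<theta>: "\<theta> \<in> ?M" "\<theta> ` S \<subseteq> frattini" "\<theta> w \<in> frattini" by auto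
    have \<theta>e: "\<theta> \<in> cont_end G T" using \<theta>(1) by blast
    show ?case
    proof (cases "\<theta> y \<in> frattini")
      case True
      then show ?thesis using \<theta> by blast
    next
      case False
      have "\<theta> y \<in> carrier G" using insert cont_end_closed[OF \<theta>e] by blast
      \<comment> \<open>In \<theta> \<circ> (\<alpha> \<circ> \<theta>) the inner \<theta> puts
        \<open>S\<close> and \<open>w\<close> into the Frattini subgroup, where they remain. The
        value \<open>\<theta> y\<close> is carried to \<open>w\<close>, which the outer \<theta>
        kills.\<close>
      then obtain \<alpha> where \<alpha>: "\<alpha> \<in> cont_aut G T" "\<alpha> (\<theta> y) = w"
        using aut_transitive_off_frattini False w by blast
      have "\<theta> \<circ> (\<alpha> \<circ> \<theta>) \<in> ?M" using \<theta>(1) M_aut[OF \<alpha>(1)] by (intro M_comp)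
      moreover have inv: "\<theta> (\<alpha> x) \<in> frattini" if "x \<in> frattini" for x
        using that frattini_fully_invariant[OF \<theta>e] frattini_fully_invariant[OF cont_aut_imp_end[OF \<alpha>(1)]] by blast
      moreover have "(\<theta> \<circ> (\<alpha> \<circ> \<theta>)) ` insert y S \<subseteq> frattini" using \<theta>(2,3) \<alpha>(2) inv by auto
      moreover have "(\<theta> \<circ> (\<alpha> \<circ> \<theta>)) w \<in> frattini" using \<theta>(3) inv by simp
      ultimately show ?thesis by blast
    qed
  qed
  obtain \<theta> where \<theta>: "\<theta> \<in> ?M" "\<theta> ` X \<subseteq> frattini" using kill[OF finite_X X_carrier] by blast
  have \<theta>e: "\<theta> \<in> cont_end G T" using \<theta>(1) by blast
  obtain N where N: "N \<lhd> G" "openin T N" "u \<notin> N" using separate_from_one[OF u] by blast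
  \<comment> \<open>The core is stable both under \<theta>, as nilpotency requires, and under the
    automorphism that later returns to \<open>u\<close>.\<close>
  let ?N = "invariant_core N"
  obtain n where n: "\<forall>x\<in>carrier G. (\<theta> ^^ n) x \<in> ?N"
    using cont_end_into_frattini_nilpotent[OF \<theta>e cont_end_into_frattini[OF \<theta>e \<theta>(2)]
        normal_invariant_core[OF N(1)] openin_invariant_core[OF N(1,2)]] invariant_core_invariant[OF \<theta>e]
    by blast
  have "id ` carrier G = carrier G" by simp
  then have "id \<in> cont_aut G T" by (rule surj_cont_end_imp_aut[OF cont_end_id])
  then have "id u \<in> aut_orbit G T u" unfolding aut_orbit_def by blast
  then have "u \<in> aut_orbit G T u" by simp
  then have "(\<theta> ^^ n) u \<in> aut_orbit G T u" using \<theta>(1) by (induction n) auto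
  then obtain \<alpha> where \<alpha>: "\<alpha> \<in> cont_aut G T" "(\<theta> ^^ n) u = \<alpha> u" by (auto simp: aut_orbit_def)
  obtain \<beta> where \<beta>: "\<beta> \<in> cont_aut G T" "\<forall>x\<in>carrier G. \<beta> (\<alpha> x) = x" using cont_aut_inverse[OF \<alpha>(1)] by blast
  \<comment> \<open>The orbit point \<open>\<alpha> u\<close> lies in the fully invariant core;
    undoing \<alpha> brings \<open>u\<close> itself into it.\<close>
  have "\<beta> (\<alpha> u) \<in> ?N" using n u(1) \<alpha>(2) by (intro invariant_core_invariant[OF cont_aut_imp_end[OF \<beta>(1)]]) metis
  then have "u \<in> ?N" using \<beta>(2) u(1) by simp
  then show False using N(3) invariant_core_subset by blast
qed

end

subsection \<open>Free pro-p groups\<close>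

lemma discrete_pro_p_group:
  assumes p: "prime p" and H: "group H" and ord: "order H = p ^ k"
  shows "pro_p_group p H (discrete_topology (carrier H))"
proof -
  interpret group H by (rule H)
  have fin: "finite (carrier H)"
    using ord p by (metis order_gt_0_iff_finite prime_gt_0_nat zero_less_power)
  let ?D = "discrete_topology (carrier H)"
  have "topological_group H ?D"
    unfolding topological_group_def
  proof (intro conjI)
    show "continuous_map (prod_topology ?D ?D) ?D (\<lambda>(x, y). x \<otimes>\<^bsub>H\<^esub> y)"
      by (simp add: prod_topology_discrete_topology[symmetric] Pi_def)
  qed (use H in auto)
  moreover have "\<exists>K. subgroup K H \<and> openin ?D K \<and> K \<subseteq> U" if "openin ?D U \<and> \<one>\<^bsub>H\<^esub> \<in> U" for U
    using that triv_subgroup by (intro exI[of _ "{\<one>\<^bsub>H\<^esub>}"]) auto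
  ultimately have "profinite_group H ?D"
    using fin Hausdorff_space_discrete_topology by (simp add: profinite_group_def compact_space_discrete_topology)
  then show ?thesis
    using card_subgroup_prime_power(2)[OF p ord] normal_imp_subgroup by (auto simp: pro_p_group_def)
qed

text \<open>Makes finite groups on any type available as targets of the universal property. Elements
  are coded by singletons of natural numbers.\<close>

lemma finite_group_copy_on_nat_set:
  assumes Q: "group Q" and fin: "finite (carrier Q)"
  shows "\<exists>(H :: nat set monoid) b. group H \<and> b \<in> iso Q H"
proof -
  interpret group Q by (rule Q)
  obtain e :: "'a \<Rightarrow> nat" where "inj_on e (carrier Q)" using fin finite_imp_inj_to_nat_seg by metis
  then have inj: "inj_on (\<lambda>x. {e x}) (carrier Q)" by (auto simp: inj_on_def)
  define b where "b x = {e x}" for x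
  define c where "c = inv_into (carrier Q) b"
  have inj: "inj_on b (carrier Q)" using inj by (simp add: b_def[abs_def])
  have cb: "c (b x) = x" if "x \<in> carrier Q" for x using inj that by (simp add: c_def)
  let ?H = "\<lparr>carrier = b ` carrier Q, monoid.mult = \<lambda>A B. b (c A \<otimes>\<^bsub>Q\<^esub> c B), one = b \<one>\<^bsub>Q\<^esub>\<rparr>"
  have hom: "b \<in> hom Q ?H" by (auto simp: hom_def cb)
  then have "group (?H\<lparr>carrier := b ` carrier Q, one := b \<one>\<^bsub>Q\<^esub>\<rparr>)" by (rule hom_imp_img_group)
  then have "group ?H" by simp
  moreover have "b \<in> iso Q ?H" using hom inj by (simp add: iso_def bij_betw_def)
  ultimately show ?thesis by blast
qed

section \<open>Continuity and equality tested on open normal subgroups\<close>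

context pro_p
begin

lemma continuous_map_discrete_if_open_kernel:
  assumes Q: "group Q" and h: "h \<in> hom G Q" and ker: "openin T {x \<in> carrier G. h x = \<one>\<^bsub>Q\<^esub>}"
  shows "continuous_map T (discrete_topology (carrier Q)) h"
proof -
  interpret h: group_hom G Q h using Q h by (simp add: group_hom_def group_hom_axioms_def is_group)
  have "openin T {x \<in> carrier G. h x \<in> U}" for U
  proof (rule openin_coset_function[OF _ ker])
    show "subgroup {x \<in> carrier G. h x = \<one>\<^bsub>Q\<^esub>} G"
      using h.subgroup_kernel by (simp add: kernel_def)
  qed auto
  then show ?thesis using h.hom_closed by (auto simp: continuous_map_def)
qed

text \<open>Continuity at the identity suffices: an open set around \<open>h x\<close> contains a
  coset of some open normal \<open>N\<close>, whose preimage contains a translate of the preimage of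
  \<open>N\<close>.\<close>

lemma cont_end_if_open_preimages:
  assumes h: "h \<in> hom G G" and pre: "\<And>N. N \<lhd> G \<Longrightarrow> openin T N \<Longrightarrow> openin T {x \<in> carrier G. h x \<in> N}"
  shows "h \<in> cont_end G T"
proof -
  interpret h: group_hom G G h using h by unfold_locales
  have "openin T {x \<in> carrier G. h x \<in> U}" if U: "openin T U" for U
  proof (subst openin_subopen, intro ballI)
    fix x assume x: "x \<in> {x \<in> carrier G. h x \<in> U}"
    have "closedin T (carrier G - U)" using U openin_imp_subset[OF U] by (simp add: closedin_def double_diff)
    then obtain N where N: "N \<lhd> G" "openin T N" "\<forall>n\<in>N. n \<otimes> h x \<notin> carrier G - U"
      using separate_from_closed[of "carrier G - U" "h x"] x by auto
    interpret N: normal N G by (rule N(1))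
    let ?W = "{y \<in> carrier G. y \<otimes> inv x \<in> {z \<in> carrier G. h z \<in> N}}"
    have "openin T ?W" using openin_translate(1)[OF pre[OF N(1,2)], of "inv x"] x by simp
    moreover have "x \<in> ?W" using x by simp
    moreover have "h y \<in> U" if y: "y \<in> ?W" for y
    proof -
      have "(h y \<otimes> inv (h x)) \<otimes> h x \<notin> carrier G - U" using N(3) x y by auto
      then show ?thesis using x y by (simp add: m_assoc)
    qed
    ultimately show "\<exists>W. openin T W \<and> x \<in> W \<and> W \<subseteq> {x \<in> carrier G. h x \<in> U}" by blast
  qed
  then show ?thesis using h by (auto simp: cont_hom_def continuous_map_def)
qed

lemma eq_if_cosets_eq:
  assumes xy: "x \<in> carrier G" "y \<in> carrier G"
    and eq: "\<And>N. N \<lhd> G \<Longrightarrow> openin T N \<Longrightarrow> N #> x = N #> y"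
  shows "x = y"
proof (rule ccontr)
  assume "x \<noteq> y"
  then have "x \<otimes> inv y \<noteq> \<one>" using xy by (metis inv_closed inv_inv inv_equality)
  then obtain N where N: "N \<lhd> G" "openin T N" "x \<otimes> inv y \<notin> N"
    using separate_from_one[of "x \<otimes> inv y"] xy by auto
  then show False using eq[OF N(1,2)] rcos_eq_iff[OF normal_imp_subgroup[OF N(1)]] xy by simp
qed

end

section \<open>From the universal property to generation and extension\<close>

locale free_pro_p = pro_p p E S for p and E :: "'a monoid" (structure) and S +
  fixes X
  assumes finite_basis: "finite X" and free: "free_pro_p_on p E S X"

context free_pro_p
begin

lemma basis_carrier: "X \<subseteq> carrier E"
  using free by (simp add: free_pro_p_on_def)

text \<open>The universal property for a finite p-group on any type, with open kernels in place of
  continuity. The problem is solved on a discrete copy \<open>H\<close> and transported back by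
  \<open>c\<close>; existence and uniqueness share this copy.\<close>

lemma finite_target:
  assumes Q: "group Q" and ord: "order Q = p ^ k" and f: "f \<in> X \<rightarrow> carrier Q"
  shows hom_into_finite_ex: "\<exists>h\<in>hom E Q. (\<forall>x\<in>X. h x = f x) \<and> openin S {y \<in> carrier E. h y = \<one>\<^bsub>Q\<^esub>}"
    and hom_into_finite_unique: "\<And>h h' y. h \<in> hom E Q \<Longrightarrow> h' \<in> hom E Q \<Longrightarrow>
      openin S {y \<in> carrier E. h y = \<one>\<^bsub>Q\<^esub>} \<Longrightarrow> openin S {y \<in> carrier E. h' y = \<one>\<^bsub>Q\<^esub>} \<Longrightarrow>
      (\<And>x. x \<in> X \<Longrightarrow> h x = f x) \<Longrightarrow> (\<And>x. x \<in> X \<Longrightarrow> h' x = f x) \<Longrightarrow> y \<in> carrier E \<Longrightarrow> h y = h' y"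
proof -
  interpret Q: group Q by (rule Q)
  have fin: "finite (carrier Q)"
    using ord prime_p by (metis Q.order_gt_0_iff_finite prime_gt_0_nat zero_less_power)
  obtain H :: "nat set monoid" and b where H: "group H" and b: "b \<in> iso Q H"
    using finite_group_copy_on_nat_set[OF Q fin] by blast
  interpret H: group H by (rule H)
  interpret b: group_hom Q H b using b by (simp add: group_hom_def group_hom_axioms_def Q H iso_def)
  have bij: "bij_betw b (carrier Q) (carrier H)" using b by (simp add: iso_def)
  define c where "c = inv_into (carrier Q) b"
  have "c \<in> iso H Q" unfolding c_def using b by (rule Q.iso_set_sym)
  then interpret c: group_hom H Q c by (simp add: group_hom_def group_hom_axioms_def Q H iso_def)
  have cb: "c (b x) = x" if "x \<in> carrier Q" for x using bij that by (simp add: c_def bij_betw_inv_into_left)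
  have b1: "b x = \<one>\<^bsub>H\<^esub> \<longleftrightarrow> x = \<one>\<^bsub>Q\<^esub>" if "x \<in> carrier Q" for x
    using cb[OF that] cb[OF Q.one_closed] by (metis b.hom_one)
  let ?D = "discrete_topology (carrier H)"
  have "order H = p ^ k" using bij_betw_same_card[OF bij] ord by (simp add: order_def)
  then have "pro_p_group p H ?D" by (rule discrete_pro_p_group[OF prime_p H])
  moreover have bf: "(\<lambda>x. b (f x)) \<in> X \<rightarrow> carrier H" using f b.hom_closed by (simp add: Pi_iff)
  ultimately have ex1: "\<exists>!h. h \<in> extensional (carrier E) \<and> h \<in> cont_hom E S H ?D \<and> (\<forall>x\<in>X. h x = b (f x))"
    using free unfolding free_pro_p_on_def by blast
  then obtain h where h: "h \<in> cont_hom E S H ?D" "\<forall>x\<in>X. h x = b (f x)" by blast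
  then have hom: "h \<in> hom E H" and cont: "continuous_map S ?D h" by (auto simp: cont_hom_def)
  interpret h: group_hom E H h using hom by (simp add: group_hom_def group_hom_axioms_def is_group H)
  have c1: "c z = \<one>\<^bsub>Q\<^esub> \<longleftrightarrow> z = \<one>\<^bsub>H\<^esub>" if z: "z \<in> carrier H" for z
  proof -
    obtain x where "x \<in> carrier Q" "z = b x" using z bij by (auto simp: bij_betw_def)
    then show ?thesis using cb b1 by simp
  qed
  have "{y \<in> carrier E. (c \<circ> h) y = \<one>\<^bsub>Q\<^esub>} = {y \<in> carrier E. h y \<in> {\<one>\<^bsub>H\<^esub>}}"
    using c1 by auto
  moreover have "openin S {y \<in> carrier E. h y \<in> {\<one>\<^bsub>H\<^esub>}}" by (rule openin_preimage[OF cont]) simp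
  moreover have "c \<circ> h \<in> hom E Q" using hom c.homh by (rule Group.hom_compose)
  moreover have "\<forall>x\<in>X. (c \<circ> h) x = f x" using h(2) cb f by auto
  ultimately show "\<exists>h\<in>hom E Q. (\<forall>x\<in>X. h x = f x) \<and> openin S {y \<in> carrier E. h y = \<one>\<^bsub>Q\<^esub>}"
    by (intro bexI[of _ "c \<circ> h"]) auto
  \<comment> \<open>The restriction is essential: freeness asserts uniqueness only among extensional
    maps.\<close>
  have lift: "restrict (b \<circ> g) (carrier E) \<in> extensional (carrier E) \<and>
      restrict (b \<circ> g) (carrier E) \<in> cont_hom E S H ?D \<and> (\<forall>x\<in>X. restrict (b \<circ> g) (carrier E) x = b (f x))"
    if g: "g \<in> hom E Q" "openin S {y \<in> carrier E. g y = \<one>\<^bsub>Q\<^esub>}" "\<And>x. x \<in> X \<Longrightarrow> g x = f x" for g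
  proof -
    have gc: "g x \<in> carrier Q" if "x \<in> carrier E" for x using hom_in_carrier[OF g(1) that] .
    have bg: "b \<circ> g \<in> hom E H" using g(1) b.homh by (rule Group.hom_compose)
    have "{y \<in> carrier E. (b \<circ> g) y = \<one>\<^bsub>H\<^esub>} = {y \<in> carrier E. g y = \<one>\<^bsub>Q\<^esub>}" using b1 gc by auto
    then have "continuous_map S ?D (b \<circ> g)" using g(2) by (intro continuous_map_discrete_if_open_kernel[OF H bg]) simp
    then have "continuous_map S ?D (restrict (b \<circ> g) (carrier E))" by (rule continuous_map_eq) simp
    moreover have "restrict (b \<circ> g) (carrier E) \<in> hom E H"
      using bg by (auto simp: hom_def)
    moreover have "\<forall>x\<in>X. restrict (b \<circ> g) (carrier E) x = b (f x)" using g(3) basis_carrier by auto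
    ultimately show ?thesis by (simp add: cont_hom_def)
  qed
  show "g y = g' y" if g: "g \<in> hom E Q" "g' \<in> hom E Q" "openin S {y \<in> carrier E. g y = \<one>\<^bsub>Q\<^esub>}"
      "openin S {y \<in> carrier E. g' y = \<one>\<^bsub>Q\<^esub>}" "\<And>x. x \<in> X \<Longrightarrow> g x = f x" "\<And>x. x \<in> X \<Longrightarrow> g' x = f x"
      "y \<in> carrier E" for g g' y
  proof -
    obtain m where m: "\<And>h. h \<in> extensional (carrier E) \<and> h \<in> cont_hom E S H ?D \<and> (\<forall>x\<in>X. h x = b (f x)) \<Longrightarrow> h = m"
      using ex1 by (elim ex1E) (rule that, blast)
    have "restrict (b \<circ> g) (carrier E) = m" by (rule m, rule lift[OF g(1,3)], rule g(5))
    moreover have "restrict (b \<circ> g') (carrier E) = m" by (rule m, rule lift[OF g(2,4)], rule g(6))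
    ultimately have "restrict (b \<circ> g) (carrier E) = restrict (b \<circ> g') (carrier E)" by simp
    from fun_cong[OF this, of y] have "b (g y) = b (g' y)" using g(7) by simp
    then have "c (b (g y)) = c (b (g' y))" by simp
    then show ?thesis unfolding cb[OF hom_in_carrier[OF g(1,7)]] cb[OF hom_in_carrier[OF g(2,7)]] .
  qed
qed

text \<open>A character killing a proper closed subgroup above \<open>X\<close> and the zero map
  would be two different extensions of the zero map on \<open>X\<close> to the group of order
  \<open>p\<close>.\<close>

lemma basis_generates:
  assumes K: "subgroup K E" "closedin S K" "X \<subseteq> K"
  shows "K = carrier E"
proof (rule ccontr)
  assume "K \<noteq> carrier E"
  then obtain \<chi> where \<chi>: "\<chi> \<in> characters" "\<forall>x\<in>K. int p dvd \<chi> x" "\<exists>x\<in>carrier E. \<not> int p dvd \<chi> x"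
    using character_separating_closed_subgroup[OF K(1,2)] by blast
  let ?Z = "integer_mod_group p"
  have p0: "p > 0" using prime_p prime_gt_0_nat by blast
  have ord: "order ?Z = p ^ 1" using p0 by (simp add: order_def carrier_integer_mod_group)
  have hom: "(\<lambda>x. \<chi> x mod int p) \<in> hom E ?Z"
    using character_mult[OF \<chi>(1)] p0
    by (auto simp: hom_def carrier_integer_mod_group cong_def mod_add_eq)
  have hom0: "(\<lambda>x. 0) \<in> hom E ?Z" using p0 by (auto simp: hom_def carrier_integer_mod_group)
  have ker: "openin S {y \<in> carrier E. \<chi> y mod int p = \<one>\<^bsub>?Z\<^esub>}"
    using openin_character_kernel[OF \<chi>(1)] by (simp add: dvd_eq_mod_eq_0)
  have ker0: "openin S {y \<in> carrier E. 0 = \<one>\<^bsub>?Z\<^esub>}" by simp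
  have "\<chi> y mod int p = 0" if "y \<in> carrier E" for y
  proof (rule hom_into_finite_unique[OF group_integer_mod_group ord _ hom hom0 ker ker0])
    show "(\<lambda>x. 0) \<in> X \<rightarrow> carrier ?Z" using p0 by (simp add: carrier_integer_mod_group)
    fix x assume "x \<in> X"
    then have "int p dvd \<chi> x" using \<chi>(2) K(3) by blast
    then show "\<chi> x mod int p = 0" by (simp add: dvd_eq_mod_eq_0)
  qed (use that in simp_all)
  then show False using \<chi>(3) by (auto simp: dvd_eq_mod_eq_0)
qed

sublocale pro_p_gen p E S X
  using finite_basis basis_carrier basis_generates by unfold_locales auto

text \<open>The universal property is only available for targets on \<^typ>\<open>nat set\<close>, so endomorphisms
  are assembled from the homomorphisms \<open>h N\<close> into the finite quotients by open normal \<open>N\<close>.\<close>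

lemma basis_extends:
  assumes f: "f \<in> X \<rightarrow> carrier E"
  shows "\<exists>h\<in>cont_end E S. \<forall>x\<in>X. h x = f x"
proof -
  let ?ON = "{N. N \<lhd> E \<and> openin S N}"
  have "\<forall>N\<in>?ON. \<exists>h. h \<in> hom E (E Mod N) \<and> (\<forall>x\<in>X. h x = N #> f x) \<and>
      openin S {y \<in> carrier E. h y = \<one>\<^bsub>E Mod N\<^esub>}"
  proof
    fix N assume N: "N \<in> ?ON"
    obtain k where k: "order (E Mod N) = p ^ k" using order_quotient N by blast
    have "(\<lambda>x. N #> f x) \<in> X \<rightarrow> carrier (E Mod N)" using f by (auto simp: carrier_FactGroup)
    then show "\<exists>h. h \<in> hom E (E Mod N) \<and> (\<forall>x\<in>X. h x = N #> f x) \<and>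
        openin S {y \<in> carrier E. h y = \<one>\<^bsub>E Mod N\<^esub>}"
      using hom_into_finite_ex[OF normal.factorgroup_is_group k] N by blast
  qed
  from bchoice[OF this] obtain h where h_all: "\<forall>N\<in>?ON. h N \<in> hom E (E Mod N) \<and> (\<forall>x\<in>X. h N x = N #> f x) \<and>
      openin S {y \<in> carrier E. h N y = \<one>\<^bsub>E Mod N\<^esub>}" ..
  have h: "\<And>N. N \<in> ?ON \<Longrightarrow> h N \<in> hom E (E Mod N)"
      "\<And>N x. N \<in> ?ON \<Longrightarrow> x \<in> X \<Longrightarrow> h N x = N #> f x"
      "\<And>N. N \<in> ?ON \<Longrightarrow> openin S {y \<in> carrier E. h N y = \<one>\<^bsub>E Mod N\<^esub>}"
    using bspec[OF h_all] by simp_all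
  \<comment> \<open>\<open>?r\<close> is the projection from \<open>E Mod M\<close> to
    \<open>E Mod N\<close>. Its composite with \<open>h M\<close> agrees with \<open>h N\<close> on
    \<open>X\<close>, hence everywhere.\<close>
  have compat: "h N y = N #> z" if MN: "M \<in> ?ON" "N \<in> ?ON" "M \<subseteq> N" and yz: "y \<in> carrier E" "z \<in> carrier E" "h M y = M #> z"
    for M N y z
  proof -
    interpret M: normal M E using MN by blast
    interpret N: normal N E using MN by blast
    interpret QM: group "E Mod M" by (rule M.factorgroup_is_group)
    interpret QN: group "E Mod N" by (rule N.factorgroup_is_group)
    let ?r = "\<lambda>C. N #> (SOME x. x \<in> carrier E \<and> C = M #> x)"
    have r: "?r (M #> x) = N #> x" if x: "x \<in> carrier E" for x
    proof -
      let ?x = "SOME x'. x' \<in> carrier E \<and> M #> x = M #> x'"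
      have s: "?x \<in> carrier E \<and> M #> x = M #> ?x" by (rule someI[of _ x]) (use x in simp)
      then have "x \<otimes> inv ?x \<in> N" using rcos_eq_iff[OF M.subgroup_axioms x, of ?x] MN(3) by blast
      then show ?thesis using rcos_eq_iff[OF N.subgroup_axioms x, of ?x] s by simp
    qed
    have rhom: "?r \<in> hom (E Mod M) (E Mod N)"
    proof (rule homI)
      fix C D assume "C \<in> carrier (E Mod M)" "D \<in> carrier (E Mod M)"
      then obtain c d where cd: "c \<in> carrier E" "d \<in> carrier E" "C = M #> c" "D = M #> d"
        unfolding carrier_FactGroup by blast
      show "?r (C \<otimes>\<^bsub>E Mod M\<^esub> D) = ?r C \<otimes>\<^bsub>E Mod N\<^esub> ?r D"
        using cd r[of c] r[of d] r[of "c \<otimes> d"] by (simp add: M.rcos_sum N.rcos_sum)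
    next
      fix C assume "C \<in> carrier (E Mod M)"
      then obtain c where "c \<in> carrier E" "C = M #> c" unfolding carrier_FactGroup by blast
      then show "?r C \<in> carrier (E Mod N)" using r[of c] by (simp add: carrier_FactGroup)
    qed
    have rh: "?r \<circ> h M \<in> hom E (E Mod N)" using h(1)[OF MN(1)] rhom by (rule Group.hom_compose)
    have r1: "?r M = N" using r[of \<one>] M.subset N.subset by (simp add: coset_mult_one)
    have "openin S {y \<in> carrier E. (?r \<circ> h M) y = \<one>\<^bsub>E Mod N\<^esub>}"
    proof (rule openin_subgroup_mono[OF _ h(3)[OF MN(1)]])
      interpret hM: group_hom E "E Mod M" "h M" using h(1)[OF MN(1)] by unfold_locales
      interpret rhM: group_hom E "E Mod N" "?r \<circ> h M" using rh by unfold_locales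
      show "subgroup {y \<in> carrier E. h M y = \<one>\<^bsub>E Mod M\<^esub>} E" using hM.subgroup_kernel by (simp add: kernel_def)
      show "subgroup {y \<in> carrier E. (?r \<circ> h M) y = \<one>\<^bsub>E Mod N\<^esub>} E" using rhM.subgroup_kernel by (simp add: kernel_def)
      show "{y \<in> carrier E. h M y = \<one>\<^bsub>E Mod M\<^esub>} \<subseteq> {y \<in> carrier E. (?r \<circ> h M) y = \<one>\<^bsub>E Mod N\<^esub>}" using r1 by auto
    qed
    moreover have "h N x = (?r \<circ> h M) x" if "x \<in> X" for x
    proof -
      have "f x \<in> carrier E" using f that by blast
      then show ?thesis using h(2)[OF MN(1) that] h(2)[OF MN(2) that] r by simp
    qed
    ultimately have "h N y = (?r \<circ> h M) y"
      using hom_eq_on_generators[OF QN.is_group h(1)[OF MN(2)] rh h(3)[OF MN(2)]] yz(1) by blast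
    then show ?thesis using yz r by simp
  qed
  have ex: "\<exists>z\<in>carrier E. \<forall>N\<in>?ON. h N y = N #> z" if y: "y \<in> carrier E" for y
  proof -
    \<comment> \<open>Candidates for the image of \<open>y\<close> as seen modulo \<open>N\<close>.
      These sets are closed, and finitely many of them share the points of \<open>C M\<close> for
      any open normal \<open>M\<close> below all the indices; compactness yields a common
      point.\<close>
    define C where "C N = {z \<in> carrier E. h N y = N #> z}" for N
    have closed: "closedin S (C N)" if N: "N \<in> ?ON" for N
    proof -
      interpret N: normal N E using N by blast
      have coset: "N #> (n \<otimes> x) = N #> x" if "n \<in> N" "x \<in> carrier E" for n x
        using that by (metis N.mem_carrier N.rcos_const N.subset coset_mult_assoc is_group)
      have "openin S {z \<in> carrier E. N #> z \<in> - {h N y}}"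
        by (rule openin_coset_function[OF N.subgroup_axioms]) (use N coset in auto)
      moreover have "carrier E - C N = {z \<in> carrier E. N #> z \<in> - {h N y}}" by (auto simp: C_def)
      ultimately show ?thesis by (auto simp: closedin_def C_def)
    qed
    have inter: "\<exists>M\<in>?ON. \<forall>N\<in>\<F>. M \<subseteq> N" if "finite \<F>" "\<F> \<subseteq> ?ON" for \<F>
      using that
    proof (induction \<F> rule: finite_induct)
      case empty
      have "carrier E \<lhd> E" by (simp add: normal_inv_iff subgroup_self)
      then show ?case by auto
    next
      case (insert N \<F>)
      then obtain M where M: "M \<in> ?ON" "\<forall>N\<in>\<F>. M \<subseteq> N" by auto
      then have "M \<inter> N \<in> ?ON" using insert normal_subgroup_intersect by auto
      then show ?case using M(2) by blast
    qed
    have "\<Inter>(C ` ?ON) \<noteq> {}"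
    proof (rule compact_space_fip[THEN iffD1, rule_format, OF compact], intro conjI allI impI ballI)
      fix D assume "D \<in> C ` ?ON"
      then show "closedin S D" using closed by blast
    next
      fix \<D> assume "finite \<D> \<and> \<D> \<subseteq> C ` ?ON"
      then obtain \<F> where F: "finite \<F>" "\<F> \<subseteq> ?ON" "\<D> = C ` \<F>" using finite_subset_image[of \<D> C ?ON] by blast
      then obtain M where M: "M \<in> ?ON" "\<forall>N\<in>\<F>. M \<subseteq> N" using inter by blast
      have "h M y \<in> carrier (E Mod M)" using hom_in_carrier[OF h(1)[OF M(1)] y] .
      then obtain z where z: "z \<in> carrier E" "h M y = M #> z" unfolding carrier_FactGroup by blast
      have "z \<in> C N" if "N \<in> \<F>" for N
        using compat[OF M(1) _ _ y z, of N] z(1) F(2) M(2) that by (auto simp: C_def)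
      then show "\<Inter>\<D> \<noteq> {}" using F(3) by blast
    qed
    then obtain z where z: "z \<in> \<Inter>(C ` ?ON)" by blast
    \<comment> \<open>The index family is nonempty, which places the common point \<open>z\<close>
      in the carrier.\<close>
    have "carrier E \<in> ?ON" by (simp add: normal_inv_iff subgroup_self)
    then show ?thesis using z by (auto simp: C_def)
  qed
  define g where "g y = (SOME z. z \<in> carrier E \<and> (\<forall>N\<in>?ON. h N y = N #> z))" for y
  have g: "g y \<in> carrier E" "\<And>N. N \<in> ?ON \<Longrightarrow> h N y = N #> g y" if "y \<in> carrier E" for y
    using someI_ex[of "\<lambda>z. z \<in> carrier E \<and> (\<forall>N\<in>?ON. h N y = N #> z)"] ex[OF that] unfolding g_def by blast+
  \<comment> \<open>The chosen values are unique, since elements congruent modulo all open normal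
    subgroups coincide; multiplicativity is inherited from the \<open>h N\<close>.\<close>
  have hom: "g \<in> hom E E"
  proof (rule homI)
    fix y z assume yz: "y \<in> carrier E" "z \<in> carrier E"
    show "g (y \<otimes> z) = g y \<otimes> g z"
    proof (rule eq_if_cosets_eq)
      fix N assume N: "N \<lhd> E" "openin S N"
      then have ON: "N \<in> ?ON" by simp
      have "N #> g (y \<otimes> z) = h N (y \<otimes> z)" using g(2)[OF _ ON] yz by simp
      also have "\<dots> = h N y <#> h N z" using hom_mult[OF h(1)[OF ON] yz] by simp
      also have "\<dots> = N #> (g y \<otimes> g z)" using g yz ON normal.rcos_sum[OF N(1)] by simp
      finally show "N #> g (y \<otimes> z) = N #> (g y \<otimes> g z)" .
    qed (use g(1) yz in auto)
  qed (use g in auto)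
  have "g \<in> cont_end E S"
  proof (rule cont_end_if_open_preimages[OF hom])
    fix N assume N: "N \<lhd> E" "openin S N"
    interpret N: normal N E by (rule N(1))
    have ON: "N \<in> ?ON" using N by simp
    have "g y \<in> N \<longleftrightarrow> h N y = \<one>\<^bsub>E Mod N\<^esub>" if "y \<in> carrier E" for y
      using g(1)[OF that] g(2)[OF that ON] by (metis N.rcos_const N.subgroup_axioms is_group one_FactGroup rcos_self)
    then have "{y \<in> carrier E. g y \<in> N} = {y \<in> carrier E. h N y = \<one>\<^bsub>E Mod N\<^esub>}" by blast
    then show "openin S {y \<in> carrier E. g y \<in> N}" using h(3)[OF ON] by simp
  qed
  moreover have "g x = f x" if "x \<in> X" for x
  proof (rule eq_if_cosets_eq)
    show "g x \<in> carrier E" "f x \<in> carrier E" using g that basis_carrier f by auto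
    fix N assume "N \<lhd> E" "openin S N"
    then show "N #> g x = N #> f x" using g(2)[of x N] h(2)[of N x] that basis_carrier by auto
  qed
  ultimately show ?thesis by blast
qed

sublocale pro_p_basis p E S X
  using basis_extends by unfold_locales

end

subsection \<open>Quotients by closed fully invariant subgroups\<close>

text \<open>\<pi> is a topological quotient map by \<open>openin_iff\<close>. With an abstract
  target instead of a set of cosets, the isomorphism from \<open>E Mod V\<close> to \<open>F\<close>
  can be absorbed into \<pi>.\<close>

locale pro_p_quotient = pro_p p E S + F: top_group F T for p and E :: "'a monoid" (structure) and S
    and F :: "'b monoid" and T +
  fixes \<pi>
  assumes hom: "\<pi> \<in> hom E F" and surj: "\<pi> ` carrier E = carrier F"
    and openin_iff: "\<And>U. U \<subseteq> carrier F \<Longrightarrow> openin T U \<longleftrightarrow> openin S {x \<in> carrier E. \<pi> x \<in> U}"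
    and closed_kernel: "closedin S {x \<in> carrier E. \<pi> x = \<one>\<^bsub>F\<^esub>}"

sublocale pro_p_quotient \<subseteq> \<pi>: group_hom E F \<pi>
  using hom by unfold_locales

context pro_p_quotient
begin

lemma preimage_ex: "y \<in> carrier F \<Longrightarrow> \<exists>x\<in>carrier E. \<pi> x = y"
  unfolding surj[symmetric] by blast

lemma continuous: "continuous_map S T \<pi>"
  unfolding continuous_map_def
proof (intro conjI allI impI)
  fix U assume U: "openin T U"
  then show "openin S {x \<in> topspace S. \<pi> x \<in> U}"
    using openin_iff[OF F.openin_imp_subset[OF U]] by simp
qed auto

lemma subgroup_preimage:
  assumes H: "subgroup H F"
  shows "subgroup {x \<in> carrier E. \<pi> x \<in> H} E"
  using subgroup.one_closed[OF H]
  by (intro subgroupI) (auto simp: subgroup.m_closed[OF H] subgroup.m_inv_closed[OF H] intro!: exI[of _ \<one>])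

lemma compact_quotient: "compact_space T"
  using image_compactin[OF _ continuous, of "carrier E"] compact surj by (simp add: compact_space_def)

text \<open>The preimage is the complement of a coset of the closed kernel.\<close>

lemma openin_singleton_complement:
  assumes a: "a \<in> carrier F"
  shows "openin T (carrier F - {a})"
proof -
  obtain z where z: "z \<in> carrier E" "\<pi> z = a" using preimage_ex[OF a] by blast
  let ?V = "{x \<in> carrier E. \<pi> x = \<one>\<^bsub>F\<^esub>}"
  have "openin S (carrier E - ?V)" using closed_kernel by (simp add: closedin_def)
  then have "openin S {x \<in> carrier E. x \<otimes> inv z \<in> carrier E - ?V}" using z(1) by (intro openin_translate) auto
  moreover have "x \<otimes> inv z \<in> carrier E - ?V \<longleftrightarrow> \<pi> x \<in> carrier F - {a}" if x: "x \<in> carrier E" for x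
  proof -
    have "\<pi> x \<otimes>\<^bsub>F\<^esub> inv\<^bsub>F\<^esub> a = \<one>\<^bsub>F\<^esub> \<longleftrightarrow> \<pi> x = a"
      using \<pi>.hom_closed[OF x] a F.inv_solve_right'[of "\<one>\<^bsub>F\<^esub>" "\<pi> x" a] by auto
    then show ?thesis using x z by auto
  qed
  then have "{x \<in> carrier E. x \<otimes> inv z \<in> carrier E - ?V} = {x \<in> carrier E. \<pi> x \<in> carrier F - {a}}"
    by blast
  ultimately have "openin S {x \<in> carrier E. \<pi> x \<in> carrier F - {a}}" by simp
  then show ?thesis using openin_iff[of "carrier F - {a}"] by blast
qed

lemma open_subgroup_nbhd:
  assumes U: "openin T U" "\<one>\<^bsub>F\<^esub> \<in> U"
  shows "\<exists>H. subgroup H F \<and> openin T H \<and> H \<subseteq> U"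
proof -
  have "openin S {x \<in> carrier E. \<pi> x \<in> U}" using openin_preimage[OF continuous U(1)] .
  moreover have "\<one> \<in> {x \<in> carrier E. \<pi> x \<in> U}" using U(2) by simp
  ultimately obtain N where N: "N \<lhd> E" "openin S N" "N \<subseteq> {x \<in> carrier E. \<pi> x \<in> U}"
    using open_normal_nbhd by meson
  interpret N: normal N E by (rule N(1))
  have sub: "subgroup (\<pi> ` N) F" by (rule \<pi>.subgroup_img_is_subgroup[OF N.subgroup_axioms])
  have "openin S {x \<in> carrier E. \<pi> x \<in> \<pi> ` N}"
  proof (rule openin_subgroup_mono[OF N.subgroup_axioms N(2) subgroup_preimage[OF sub]])
    show "N \<subseteq> {x \<in> carrier E. \<pi> x \<in> \<pi> ` N}" using N.subset by blast
  qed
  then have "openin T (\<pi> ` N)" using openin_iff[OF subgroup.subset[OF sub]] by blast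
  moreover have "\<pi> ` N \<subseteq> U" using N(3) by blast
  ultimately show ?thesis using sub by blast
qed

text \<open>An open subgroup \<open>H\<close> that avoids the quotient of \<open>x\<close> by
  \<open>y\<close> puts the two points into different, hence disjoint, open cosets.\<close>

lemma Hausdorff_quotient: "Hausdorff_space T"
  unfolding Hausdorff_space_def
proof (intro allI impI)
  fix x y assume "x \<in> topspace T \<and> y \<in> topspace T \<and> x \<noteq> y"
  then have x: "x \<in> carrier F" and y: "y \<in> carrier F" and xy: "x \<noteq> y" by auto
  let ?a = "x \<otimes>\<^bsub>F\<^esub> inv\<^bsub>F\<^esub> y"
  have a: "?a \<in> carrier F" using x y by simp
  have "?a \<noteq> \<one>\<^bsub>F\<^esub>" using F.inv_solve_right'[of "\<one>\<^bsub>F\<^esub>" x y] x y xy by auto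
  then have "\<one>\<^bsub>F\<^esub> \<in> carrier F - {?a}" by auto
  then obtain H where H: "subgroup H F" "openin T H" "H \<subseteq> carrier F - {?a}"
    using open_subgroup_nbhd[OF openin_singleton_complement[OF a]] by blast
  let ?U = "\<lambda>z. {w \<in> carrier F. w \<otimes>\<^bsub>F\<^esub> inv\<^bsub>F\<^esub> z \<in> H}"
  have one: "\<one>\<^bsub>F\<^esub> \<in> H" by (rule subgroup.one_closed[OF H(1)])
  have "openin T (?U x)" "openin T (?U y)" using F.openin_translate(1)[OF H(2)] x y by auto
  moreover have "x \<in> ?U x" "y \<in> ?U y" using x y one by auto
  moreover have "disjnt (?U x) (?U y)"
  proof -
    have False if "w \<in> ?U x" "w \<in> ?U y" for w
    proof -
      have "H #>\<^bsub>F\<^esub> w = H #>\<^bsub>F\<^esub> x" "H #>\<^bsub>F\<^esub> w = H #>\<^bsub>F\<^esub> y"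
        using F.rcos_eq_iff[OF H(1)] that x y by auto
      then have "?a \<in> H" using F.rcos_eq_iff[OF H(1) x y] by simp
      then show False using H(3) by blast
    qed
    then show ?thesis unfolding disjnt_def by blast
  qed
  ultimately show "\<exists>U V. openin T U \<and> openin T V \<and> x \<in> U \<and> y \<in> V \<and> disjnt U V"
    by (intro exI[of _ "?U x"] exI[of _ "?U y"] conjI)
qed

text \<open>By the first isomorphism theorem the index equals that of the preimage of
  \<open>N\<close>, an open normal subgroup of \<open>E\<close>.\<close>

lemma index_quotient:
  assumes N: "N \<lhd> F" "openin T N"
  shows "\<exists>k. card (rcosets\<^bsub>F\<^esub> N) = p ^ k"
proof -
  interpret N: normal N F by (rule N(1))
  interpret Q: group "F Mod N" by (rule N.factorgroup_is_group)
  let ?q = "(\<lambda>x. N #>\<^bsub>F\<^esub> x) \<circ> \<pi>"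
  have q: "?q \<in> hom E (F Mod N)" using hom N.r_coset_hom_Mod by (rule Group.hom_compose)
  interpret q: group_hom E "F Mod N" ?q using q by unfold_locales
  have "?q ` carrier E = carrier (F Mod N)"
    using surj by (metis carrier_FactGroup image_comp)
  then have "E Mod (kernel E (F Mod N) ?q) \<cong> F Mod N" by (rule q.FactGroup_iso)
  then have card: "card (carrier (E Mod (kernel E (F Mod N) ?q))) = card (carrier (F Mod N))" by (rule iso_same_card)
  have "N #>\<^bsub>F\<^esub> y = N \<longleftrightarrow> y \<in> N" if "y \<in> carrier F" for y
    using that by (metis N.rcos_const N.subgroup_axioms F.is_group F.rcos_self)
  then have "kernel E (F Mod N) ?q = {x \<in> carrier E. \<pi> x \<in> N}" 
    by (simp add: kernel_def cong: conj_cong)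
  then have "openin S (kernel E (F Mod N) ?q)" using openin_preimage[OF continuous N(2)] by simp
  then show ?thesis using order_quotient[OF q.normal_kernel] card by (simp add: order_def FactGroup_def)
qed

lemma pro_p_group_quotient: "pro_p_group p F T"
  using F.top_group compact_quotient Hausdorff_quotient open_subgroup_nbhd index_quotient
  unfolding pro_p_group_def profinite_group_def by blast

text \<open>\<open>h\<close> preserves the kernel, so the choice of preimages \<open>s\<close> does
  not affect \<open>g\<close> on the values of \<pi>. Continuity descends because \<pi> is a
  quotient map.\<close>

lemma induced_cont_end:
  assumes h: "h \<in> cont_end E S" and ker: "\<And>x. x \<in> carrier E \<Longrightarrow> \<pi> x = \<one>\<^bsub>F\<^esub> \<Longrightarrow> \<pi> (h x) = \<one>\<^bsub>F\<^esub>"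
  shows "\<exists>g\<in>cont_end F T. \<forall>x\<in>carrier E. g (\<pi> x) = \<pi> (h x)"
proof -
  interpret h: group_hom E E h using h by unfold_locales (simp add: cont_hom_def)
  define s where "s y = (SOME x. x \<in> carrier E \<and> \<pi> x = y)" for y
  define g where "g y = \<pi> (h (s y))" for y
  have s: "s y \<in> carrier E \<and> \<pi> (s y) = y" if "y \<in> carrier F" for y
    unfolding s_def by (rule someI_ex) (use preimage_ex[OF that] in blast)
  have g: "g (\<pi> x) = \<pi> (h x)" if x: "x \<in> carrier E" for x
  proof -
    have sx: "s (\<pi> x) \<in> carrier E" "\<pi> (s (\<pi> x)) = \<pi> x" using s[of "\<pi> x"] x by auto
    then have "\<pi> (s (\<pi> x) \<otimes> inv x) = \<one>\<^bsub>F\<^esub>" using x by simp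
    then have "\<pi> (h (s (\<pi> x) \<otimes> inv x)) = \<one>\<^bsub>F\<^esub>" using sx x by (intro ker) auto
    then have "\<pi> (h (s (\<pi> x))) \<otimes>\<^bsub>F\<^esub> inv\<^bsub>F\<^esub> \<pi> (h x) = \<one>\<^bsub>F\<^esub>" using sx x by simp
    then have "\<pi> (h (s (\<pi> x))) = \<pi> (h x)"
      using F.inv_solve_right'[of "\<one>\<^bsub>F\<^esub>" "\<pi> (h (s (\<pi> x)))" "\<pi> (h x)"] sx x by auto
    then show ?thesis by (simp add: g_def)
  qed
  have ghom: "g \<in> hom F F"
  proof (rule homI)
    fix y z assume yz: "y \<in> carrier F" "z \<in> carrier F"
    then obtain a b where ab: "a \<in> carrier E" "\<pi> a = y" "b \<in> carrier E" "\<pi> b = z" using preimage_ex by metis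
    have "g (\<pi> (a \<otimes> b)) = \<pi> (h (a \<otimes> b))" using ab by (intro g) simp
    then have "g (y \<otimes>\<^bsub>F\<^esub> z) = \<pi> (h a) \<otimes>\<^bsub>F\<^esub> \<pi> (h b)" using ab by simp
    then show "g (y \<otimes>\<^bsub>F\<^esub> z) = g y \<otimes>\<^bsub>F\<^esub> g z" using g[OF ab(1)] g[OF ab(3)] ab by simp
  next
    fix y assume "y \<in> carrier F"
    then show "g y \<in> carrier F" using s by (simp add: g_def)
  qed
  have gc: "g y \<in> carrier F" if "y \<in> carrier F" for y using hom_in_carrier[OF ghom that] .
  have "openin T {y \<in> carrier F. g y \<in> U}" if U: "openin T U" for U
  proof -
    have "continuous_map S T (\<pi> \<circ> h)"
      using continuous_map_compose[OF _ continuous, of S h] h by (simp add: cont_hom_def)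
    then have "openin S {x \<in> carrier E. (\<pi> \<circ> h) x \<in> U}" using U by (rule openin_preimage)
    moreover have "{x \<in> carrier E. \<pi> x \<in> {y \<in> carrier F. g y \<in> U}} = {x \<in> carrier E. (\<pi> \<circ> h) x \<in> U}"
      using g by auto
    ultimately show ?thesis using openin_iff[of "{y \<in> carrier F. g y \<in> U}"] by auto
  qed
  then have "continuous_map T T g" using gc by (auto simp: continuous_map_def)
  then show ?thesis using ghom g by (intro bexI[of _ g]) (auto simp: cont_hom_def)
qed

end

lemma (in pro_p_quotient) pro_p_basis_quotient:
  assumes X: "pro_p_basis p E S X"
    and inv: "\<And>h x. h \<in> cont_end E S \<Longrightarrow> x \<in> carrier E \<Longrightarrow> \<pi> x = \<one>\<^bsub>F\<^esub> \<Longrightarrow> \<pi> (h x) = \<one>\<^bsub>F\<^esub>"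
  shows "pro_p_basis p F T (\<pi> ` X)"
proof -
  interpret X: pro_p_basis p E S X by (rule X)
  interpret F': pro_p p F T using prime_p pro_p_group_quotient by unfold_locales
  show ?thesis
  proof unfold_locales
    show "finite (\<pi> ` X)" using X.finite_X by simp
    show "\<pi> ` X \<subseteq> carrier F" using X.X_carrier by auto
  next
    fix K assume K: "subgroup K F" "closedin T K" "\<pi> ` X \<subseteq> K"
    have "closedin S {x \<in> topspace S. \<pi> x \<in> K}" using continuous K(2) by (rule closedin_continuous_map_preimage)
    then have "{x \<in> carrier E. \<pi> x \<in> K} = carrier E"
      using K(3) X.X_carrier subgroup_preimage[OF K(1)] by (intro X.generates) auto
    then have "carrier F \<subseteq> K" unfolding surj[symmetric] by blast
    then show "K = carrier F" using subgroup.subset[OF K(1)] by blast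
  next
    fix f assume f: "f \<in> \<pi> ` X \<rightarrow> carrier F"
    have "\<forall>x\<in>X. \<exists>z. z \<in> carrier E \<and> \<pi> z = f (\<pi> x)" using f preimage_ex by blast
    \<comment> \<open>Lifts are indexed by \<open>X\<close> rather than by its image, so elements
      identified by \<pi> cause no conflict: their lifts all lie over the same value of
      \<open>f\<close>.\<close>
    from bchoice[OF this] obtain z where z: "\<forall>x\<in>X. z x \<in> carrier E \<and> \<pi> (z x) = f (\<pi> x)" ..
    then have "z \<in> X \<rightarrow> carrier E" by blast
    then obtain h where h: "h \<in> cont_end E S" "\<forall>x\<in>X. h x = z x" using X.extends by blast
    then obtain g where g: "g \<in> cont_end F T" "\<forall>x\<in>carrier E. g (\<pi> x) = \<pi> (h x)"
      using induced_cont_end[OF h(1) inv[OF h(1)]] by blast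
    have "g (\<pi> x) = f (\<pi> x)" if "x \<in> X" for x using g(2) h(2) z that X.X_carrier by auto
    then show "\<exists>h\<in>cont_end F T. \<forall>x\<in>\<pi> ` X. h x = f x" using g(1) by blast
  qed
qed

section \<open>Bases of relatively free pro-p groups\<close>

context pro_p
begin

lemma conjugation_cont_end:
  assumes a: "a \<in> carrier G"
  shows "(\<lambda>x. a \<otimes> x \<otimes> inv a) \<in> cont_end G T"
  using a by (auto simp: cont_hom_def hom_def m_assoc inv_cancel_assoc intro!: continuous_map_mult)

lemma closed_fully_invariant_normal:
  assumes V: "closed_fully_invariant V G T"
  shows "V \<lhd> G"
proof -
  have sub: "subgroup V G" and inv: "\<And>f. f \<in> cont_end G T \<Longrightarrow> f ` V \<subseteq> V"
    using V by (auto simp: closed_fully_invariant_def)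
  have "x \<otimes> v \<otimes> inv x \<in> V" if "x \<in> carrier G" "v \<in> V" for x v
    using inv[OF conjugation_cont_end[OF that(1)]] that(2) by blast
  then show ?thesis using sub by (simp add: normal_inv_iff)
qed

end

lemma relatively_free_pro_p_imp_basis:
  assumes p: "prime p" and rf: "relatively_free_pro_p TYPE('e) p F T"
  shows "\<exists>X. pro_p_basis p F T X"
proof -
  obtain E :: "'e monoid" and S V \<iota> where top: "topological_group F T" and E: "free_pro_p_finite_rank p E S"
    and V: "closed_fully_invariant V E S" and \<iota>: "\<iota> \<in> cont_iso (E Mod V) (quotient_group_topology E S V) F T"
    using rf unfolding relatively_free_pro_p_def by blast
  obtain X where X: "finite X" "free_pro_p_on p E S X" using E by (auto simp: free_pro_p_finite_rank_def)
  interpret E: free_pro_p p E S X using p X by unfold_locales (auto simp: free_pro_p_on_def)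
  interpret F: top_group F T using top by unfold_locales
  interpret V: normal V E by (rule E.closed_fully_invariant_normal[OF V])
  let ?Q = "quotient_group_topology E S V"
  have iso: "\<iota> \<in> hom (E Mod V) F" and bij: "bij_betw \<iota> (carrier (E Mod V)) (carrier F)"
    and homeo: "homeomorphic_map ?Q T \<iota>" using \<iota> by (auto simp: cont_iso_def iso_def)
  have "carrier (E Mod V) \<subseteq> topspace ?Q"
  proof (rule openin_subset)
    have "{x \<in> topspace S. V #>\<^bsub>E\<^esub> x \<in> carrier (E Mod V)} = carrier E" by (auto simp: carrier_FactGroup)
    then show "openin ?Q (carrier (E Mod V))" by (simp add: openin_quotient_group_topology)
  qed
  moreover have "topspace ?Q \<subseteq> carrier (E Mod V)"
    using openin_topspace[of ?Q] unfolding openin_quotient_group_topology by blast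
  ultimately have topQ: "topspace ?Q = carrier (E Mod V)" by blast
  let ?\<pi> = "\<iota> \<circ> (\<lambda>x. V #>\<^bsub>E\<^esub> x)"
  have kernel: "?\<pi> x = \<one>\<^bsub>F\<^esub> \<longleftrightarrow> x \<in> V" if x: "x \<in> carrier E" for x
  proof -
    interpret \<iota>: group_hom "E Mod V" F \<iota>
      using iso V.factorgroup_is_group F.is_group by (simp add: group_hom_def group_hom_axioms_def)
    have "\<iota> (V #>\<^bsub>E\<^esub> x) = \<iota> V \<longleftrightarrow> V #>\<^bsub>E\<^esub> x = V"
    proof (rule inj_on_eq_iff)
      show "inj_on \<iota> (carrier (E Mod V))" using bij by (simp add: bij_betw_def)
      show "V #>\<^bsub>E\<^esub> x \<in> carrier (E Mod V)" using x by (simp add: carrier_FactGroup)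
      show "V \<in> carrier (E Mod V)" using group.is_monoid[OF V.factorgroup_is_group] monoid.one_closed by fastforce
    qed
    moreover have "\<iota> V = \<one>\<^bsub>F\<^esub>" using \<iota>.hom_one by simp
    moreover have "V #>\<^bsub>E\<^esub> x = V \<longleftrightarrow> x \<in> V"
      using x by (metis V.rcos_const V.subgroup_axioms E.is_group E.rcos_self)
    ultimately show ?thesis by simp
  qed
  interpret Q: pro_p_quotient p E S F T ?\<pi>
  proof unfold_locales
    show "?\<pi> \<in> hom E F" using V.r_coset_hom_Mod iso by (rule Group.hom_compose)
    show "?\<pi> ` carrier E = carrier F" using bij by (simp add: bij_betw_def carrier_FactGroup image_comp)
    show "closedin S {x \<in> carrier E. ?\<pi> x = \<one>\<^bsub>F\<^esub>}"
    proof -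
      have "{x \<in> carrier E. ?\<pi> x = \<one>\<^bsub>F\<^esub>} = V" using kernel V.subset by blast
      then show ?thesis using V by (simp add: closed_fully_invariant_def)
    qed
    fix U assume U: "U \<subseteq> carrier F"
    \<comment> \<open>The homeomorphism \<iota> reduces openness of \<open>U\<close> to that of a
      set of cosets, which by definition of the quotient topology is openness of its preimage in
      \<open>E\<close>.\<close>
    let ?W = "{C \<in> carrier (E Mod V). \<iota> C \<in> U}"
    have "U \<subseteq> \<iota> ` carrier (E Mod V)" using U bij by (simp add: bij_betw_def)
    then have image: "\<iota> ` ?W = U" by blast
    have "?W \<subseteq> topspace ?Q" unfolding topQ by blast
    from homeomorphic_map_openness[OF homeo this] have "openin T U \<longleftrightarrow> openin ?Q ?W" unfolding image .
    also have "\<dots> \<longleftrightarrow> openin S {x \<in> topspace S. V #>\<^bsub>E\<^esub> x \<in> ?W}"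
      by (auto simp: openin_quotient_group_topology)
    also have "{x \<in> topspace S. V #>\<^bsub>E\<^esub> x \<in> ?W} = {x \<in> carrier E. ?\<pi> x \<in> U}"
      by (auto simp: carrier_FactGroup)
    finally show "openin T U \<longleftrightarrow> openin S {x \<in> carrier E. ?\<pi> x \<in> U}" .
  qed
  have "pro_p_basis p F T (?\<pi> ` X)"
  proof (rule Q.pro_p_basis_quotient[OF E.pro_p_basis_axioms])
    fix h x assume hx: "h \<in> cont_end E S" "x \<in> carrier E" "?\<pi> x = \<one>\<^bsub>F\<^esub>"
    then have "h x \<in> V" using kernel V unfolding closed_fully_invariant_def by blast
    then show "?\<pi> (h x) = \<one>\<^bsub>F\<^esub>" using kernel E.cont_end_closed[OF hx(1,2)] by blast
  qed
  then show ?thesis by blast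
qed

theorem corollary4p6:
  fixes p :: nat and F :: "'a monoid" and T :: "'a topology"
    and u :: 'a and \<phi> :: "'a \<Rightarrow> 'a"
  assumes "prime p"
    and "u \<in> carrier F" and "u \<noteq> \<one>\<^bsub>F\<^esub>"
    and "\<phi> \<in> cont_end F T"
    and "\<phi> ` aut_orbit F T u \<subseteq> aut_orbit F T u"
  shows "(relatively_free_pro_p TYPE('e) p F T \<longrightarrow> \<phi> \<in> cont_aut F T) \<and>
         (free_pro_p_finite_rank p F T \<longrightarrow> \<phi> \<in> cont_aut F T)"
proof (intro conjI impI)
  assume "relatively_free_pro_p TYPE('e) p F T"
  then obtain X where "pro_p_basis p F T X" using relatively_free_pro_p_imp_basis assms(1) by blast
  then show "\<phi> \<in> cont_aut F T" using assms(2-5) by (rule pro_p_basis.orbit_preserving_cont_end_is_aut)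
next
  assume "free_pro_p_finite_rank p F T"
  then obtain X where X: "finite X" "free_pro_p_on p F T X" by (auto simp: free_pro_p_finite_rank_def)
  \<comment> \<open>Freeness yields a basis of \<open>F\<close> itself through the sublocales,
    without passing to a quotient.\<close>
  interpret free_pro_p p F T X using assms(1) X by unfold_locales (auto simp: free_pro_p_on_def)
  show "\<phi> \<in> cont_aut F T" using assms(2-5) by (rule orbit_preserving_cont_end_is_aut)
qed

end
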